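(* Let $X=(X_t)_{t\ge0}$ be a one-dimensional Markov process satisfying the following condition X: the process $X$ possesses a transition probability density $p_t(x,y)$ that is differentiable with respect to $t$ and satisfies $$|\partial_t p_t(x,y)|\le C_T\, t^{-1} q_{t,x}(y),\qquad t\le T,\quad C_T\ge 1,$$ for some measurable function $q$ such that for any fixed $t$ and $x$ the function $q_{t,x}$ is a distribution density. Let the price of an asset be $S_t=S_0\exp(X_t)$, $t\ge 0$, and for the strike price $K$, the barrier $L$, the knock-out rate $\rho$ and the risk-free interest rate $r$ set $$\mathbf{C}(T)=\exp(-rT)\,E\left[\exp\left(-\rho\int_0^T\mathbb{I}_{\{S_t\le L\}}\,dt\right)(S_T-K)_+\right],$$ $$\mathbf{C}_n(T)=\exp(-rT)\,E\left[\exp\left(-\rho\,\frac{T}{n}\sum_{k=0}^{n-1}\mathbb{I}_{\{S_{kT/n}\le L\}}\right)(S_T-K)_+\right].$$ Suppose that there exists $u>1$ such that $G:=E\exp(uX_T)=E S_T^u<+\infty$. Then $$\big|\mathbf{C}_n(T)-\mathbf{C}(T)\big|\le 3\max\{C_{T,\rho},G\}\,\exp(-rT)\left(\frac{\log n}{n^{1-1/u}}\right),$$ where $C_{T,\rho}=6C_T\,\rho T(1+\rho T)\exp(\rho T)$.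
   Context: $E$ denotes expectation, $\mathbb{I}$ an indicator, and $a_+=\max(a,0)$. $\mathbf{C}(T)$ is the price of a down-and-out call occupation-time option, whose payoff is $\exp\big(-\rho\int_0^T\mathbb{I}_{\{S_t\le L\}}dt\big)(S_T-K)_+$, and $\mathbf{C}_n(T)$ is its discrete approximation, in which the time integral is replaced by an integral sum with $n$ terms.
   Formalization: n ≥ 2 is required, since for n = 1 the right-hand side is 0 and the bound fails; G is taken as E S_T^u, since E exp(uX_T) = E S_T^u holds only for S_0 = 1 and the bound with E exp(uX_T) fails for large S_0. *)

theory Defs
  imports "HOL-Probability.Probability"
begin

definition prob_density :: "(real \<Rightarrow> real) \<Rightarrow> bool" where
  "prob_density f \<longleftrightarrow>
     f \<in> borel_measurable borel \<and> (\<forall>y. 0 \<le> f y) \<and> (\<integral>\<^sup>+y. ennreal (f y) \<partial>lborel) = 1"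

definition natural_filtration :: "'w measure \<Rightarrow> (real \<Rightarrow> 'w \<Rightarrow> real) \<Rightarrow> real \<Rightarrow> 'w measure" where
  "natural_filtration M X s =
     sigma (space M) {X v -` A \<inter> space M | v A. v \<in> {0..s} \<and> A \<in> sets borel}"

text \<open>Joint measurability in time and \<open>\<omega>\<close> (automatic for right-continuous paths); it is what makes
  the occupation time of a trajectory well defined.\<close>

definition measurable_process :: "'w measure \<Rightarrow> (real \<Rightarrow> 'w \<Rightarrow> real) \<Rightarrow> bool" where
  "measurable_process M X \<longleftrightarrow>
     (\<lambda>(t, \<omega>). X t \<omega>) \<in> borel_measurable (restrict_space borel {0..} \<Otimes>\<^sub>M M)"

text \<open>Time-homogeneous real-valued Markov process with transition density \<open>p t x y\<close>, \<open>t > 0\<close>; the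
  Markov property is with respect to the filtration of the process itself, and the law of \<open>X 0\<close> is
  arbitrary. Values of \<open>p t x y\<close> for \<open>t \<le> 0\<close> are irrelevant. The Chapman--Kolmogorov identity is
  required only to the extent that it follows from the Markov property.\<close>

definition markov_process_with_density ::
  "'w measure \<Rightarrow> (real \<Rightarrow> 'w \<Rightarrow> real) \<Rightarrow> (real \<Rightarrow> real \<Rightarrow> real \<Rightarrow> real) \<Rightarrow> bool" where
  "markov_process_with_density M X p \<longleftrightarrow>
     measurable_process M X \<and>
     (\<forall>t>0. (\<lambda>(x, y). p t x y) \<in> borel_measurable borel) \<and>
     (\<forall>t>0. \<forall>x. prob_density (p t x)) \<and>
     (\<forall>s\<ge>0. \<forall>t>s. \<forall>A\<in>sets borel.
        AE \<omega> in M. real_cond_exp M (natural_filtration M X s) (\<lambda>\<omega>'. indicator A (X t \<omega>')) \<omega>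
                   = (LBINT y:A. p (t - s) (X s \<omega>) y))"

text \<open>Condition X on the time horizon \<open>T\<close>, with constant \<open>CT\<close> and dominating densities \<open>q t x\<close>.\<close>

definition condition_X ::
  "(real \<Rightarrow> real \<Rightarrow> real \<Rightarrow> real) \<Rightarrow> (real \<Rightarrow> real \<Rightarrow> real \<Rightarrow> real) \<Rightarrow> real \<Rightarrow> real \<Rightarrow> bool" where
  "condition_X p q T CT \<longleftrightarrow>
     CT \<ge> 1 \<and>
     (\<lambda>(t, x, y). q t x y) \<in> borel_measurable (restrict_space borel ({0<..} \<times> UNIV \<times> UNIV)) \<and>
     (\<forall>t>0. \<forall>x. prob_density (q t x)) \<and>
     (\<forall>t>0. \<forall>x y. (\<lambda>s. p s x y) differentiable (at t)) \<and>
     (\<forall>t x y. 0 < t \<and> t \<le> T \<longrightarrow> \<bar>deriv (\<lambda>s. p s x y) t\<bar> \<le> CT * inverse t * q t x y)"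

definition asset_price :: "real \<Rightarrow> (real \<Rightarrow> 'w \<Rightarrow> real) \<Rightarrow> real \<Rightarrow> 'w \<Rightarrow> real" where
  "asset_price S0 X t \<omega> = S0 * exp (X t \<omega>)"

definition option_price ::
  "'w measure \<Rightarrow> (real \<Rightarrow> 'w \<Rightarrow> real) \<Rightarrow> real \<Rightarrow> real \<Rightarrow> real \<Rightarrow> real \<Rightarrow> real \<Rightarrow> real" where
  "option_price M S r \<rho> K L T =
     exp (- r * T) *
     (\<integral>\<omega>. exp (- \<rho> * (LBINT t:{0..T}. indicator {..L} (S t \<omega>))) * max (S T \<omega> - K) 0 \<partial>M)"

definition option_price_approx ::
  "'w measure \<Rightarrow> (real \<Rightarrow> 'w \<Rightarrow> real) \<Rightarrow> real \<Rightarrow> real \<Rightarrow> real \<Rightarrow> real \<Rightarrow> nat \<Rightarrow> real \<Rightarrow> real" where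
  "option_price_approx M S r \<rho> K L n T =
     exp (- r * T) *
     (\<integral>\<omega>. exp (- \<rho> * (T / real n) * (\<Sum>k<n. indicator {..L} (S (real k * T / real n) \<omega>)))
           * max (S T \<omega> - K) 0 \<partial>M)"

definition const_T_rho :: "real \<Rightarrow> real \<Rightarrow> real \<Rightarrow> real" where
  "const_T_rho CT T \<rho> = 6 * CT * \<rho> * T * (1 + \<rho> * T) * exp (\<rho> * T)"

end

(* Write delta = T/n and compare the two exponentials cell by cell: their difference telescopes into
   a sum over k of (discount up to k delta, continuous clock) * (error on the cell) * (discount after
   (k+1) delta, discrete clock), and up to O((rho delta)^2) the cell error is
   -rho times the integral of h(X_t) - h(X_{k delta}), h the indicator of the knock-out region.

   If the past factor is known at time v < k delta and the future factor is a function of the path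
   after w > (k+1) delta, then the Markov property and the bound C/t on the L^1 norm of the time
   derivative of p_t give
     |E[Y (h(X_t) - h(X_s)) g(X_w)]| <= |Y| |g| C ((t-s)/(s-v) + (t-s)/(w-t)).
   The actual past and future factors reach up to the cell, so both are expanded into telescoping
   sums of increments of size rho delta; the increments at distance m from the cell contribute C/m,
   which sums to the harmonic number behind log n.

   An unbounded payoff is truncated at n^(1/u); the tail costs at most G n^(1/u - 1). *)
theory Submission
  imports Defs
begin

section \<open>Time regularity of the transition operator\<close>

text \<open>The order of the two clocks is what makes both factors tractable. The past runs on the
  continuous clock, and all that is asked of it is to be known, almost surely, at its own time. The
  future runs on the discrete clock, so it is a finite product: iterated one-step transitions turn
  it, together with the payoff, into a function of the position at a single time. This is why the
  smoothing estimate only has to treat a factor g(X_w).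

  The weight 1/m arises because a layer m cells away leaves a gap of at least m \<delta>, while t -
  s is at most \<delta>, so that \<delta> cancels. On each side of the cell the layer sizes add up
  to at most 1 + \<rho> T; this gives (1 + \<rho> T)^2, and one of the two powers is absorbed into
  exp(\<rho> T).

  The truncation level N = n^(1/u) balances two costs: the bounded part costs a multiple of N log n
  / n and the tail costs G N^(1 - u), both with the power n^(1/u - 1).\<close>

lemma abs_mult_le:
  fixes a b :: real
  assumes "\<bar>a\<bar> \<le> c" "\<bar>b\<bar> \<le> d" shows "\<bar>a * b\<bar> \<le> c * d"
  using assms by (auto simp: abs_mult intro!: mult_mono)

lemma integrable_indicator_Icc: "integrable lborel (indicator {a..b::real} :: real \<Rightarrow> real)"
  by (rule integrable_real_indicator) (auto simp: emeasure_lborel_Icc_eq)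

definition transition :: "(real \<Rightarrow> real \<Rightarrow> real \<Rightarrow> real) \<Rightarrow> real \<Rightarrow> (real \<Rightarrow> real) \<Rightarrow> real \<Rightarrow> real" where
  "transition p t g x = (\<integral>y. p t x y * g y \<partial>lborel)"

lemma prob_density_integral:
  assumes "prob_density f"
  shows "integrable lborel f" "(\<integral>y. f y \<partial>lborel) = 1"
proof -
  have *: "has_bochner_integral lborel f 1"
    using assms by (intro has_bochner_integral_nn_integral) (auto simp: prob_density_def)
  show "integrable lborel f" "(\<integral>y. f y \<partial>lborel) = 1"
    using * by (auto simp: has_bochner_integral_iff)
qed

lemma prob_density_integrable_mult:
  assumes "prob_density f" "g \<in> borel_measurable borel" "\<And>y. \<bar>g y\<bar> \<le> d"
  shows "integrable lborel (\<lambda>y. f y * g y)"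
proof (rule Bochner_Integration.integrable_bound[where f = "\<lambda>y. d * f y"])
  show "integrable lborel (\<lambda>y. d * f y)"
    using prob_density_integral[OF assms(1)] by simp
  show "(\<lambda>y. f y * g y) \<in> borel_measurable lborel"
    using assms by (auto simp: prob_density_def)
  show "AE y in lborel. norm (f y * g y) \<le> norm (d * f y)"
  proof (rule AE_I2)
    fix y
    have "0 \<le> f y" using assms(1) by (simp add: prob_density_def)
    then show "norm (f y * g y) \<le> norm (d * f y)"
      using mult_left_mono[of "\<bar>g y\<bar>" "\<bar>d\<bar>" "f y"] assms(3)[of y] by (simp add: abs_mult mult.commute)
  qed
qed

lemma prob_density_integral_bound:
  assumes "prob_density f" "g \<in> borel_measurable borel" "\<And>y. \<bar>g y\<bar> \<le> d"
  shows "\<bar>\<integral>y. f y * g y \<partial>lborel\<bar> \<le> d"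
proof -
  have "\<bar>\<integral>y. f y * g y \<partial>lborel\<bar> \<le> (\<integral>y. \<bar>f y * g y\<bar> \<partial>lborel)"
    by (rule integral_abs_bound)
  also have "\<dots> \<le> (\<integral>y. d * f y \<partial>lborel)"
  proof (rule integral_mono)
    show "integrable lborel (\<lambda>y. \<bar>f y * g y\<bar>)"
      using prob_density_integrable_mult[OF assms] by simp
    show "integrable lborel (\<lambda>y. d * f y)"
      using prob_density_integral[OF assms(1)] by simp
    fix y
    have "0 \<le> f y" using assms(1) by (simp add: prob_density_def)
    then show "\<bar>f y * g y\<bar> \<le> d * f y"
      using mult_left_mono[of "\<bar>g y\<bar>" d "f y"] assms(3)[of y] by (simp add: abs_mult mult.commute)
  qed
  also have "\<dots> = d" using prob_density_integral[OF assms(1)] by simp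
  finally show ?thesis .
qed

text \<open>For fixed y the increment is the time integral of the derivative, and on [s, t] the
  factor 1/r is at most 1/s. Integrating over y and exchanging the integrals leaves the mass of each
  density \<open>q r x\<close>, which is 1, over a time interval of length t - s.\<close>

lemma condition_X_increment_nn:
  assumes cond: "condition_X p q T CT" and st: "0 < s" "s < t" "t \<le> T"
  shows "(\<integral>\<^sup>+y. ennreal \<bar>p t x y - p s x y\<bar> \<partial>lborel) \<le> ennreal (CT * (t - s) / s)"
proof -
  have C: "CT \<ge> 1" and qd: "\<And>t x. t > 0 \<Longrightarrow> prob_density (q t x)"
    and diff: "\<And>t x y. t > 0 \<Longrightarrow> (\<lambda>s. p s x y) differentiable (at t)"
    and bound: "\<And>t x y. 0 < t \<Longrightarrow> t \<le> T \<Longrightarrow> \<bar>deriv (\<lambda>s. p s x y) t\<bar> \<le> CT * inverse t * q t x y"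
    using cond by (auto simp: condition_X_def)
  have qnn: "t > 0 \<Longrightarrow> 0 \<le> q t x y" for t x y using qd by (simp add: prob_density_def)
  define Q where "Q = (\<lambda>(r, y). indicator {s..t} r * q r x y)"
  have Qm[measurable]: "Q \<in> borel_measurable (borel \<Otimes>\<^sub>M borel)"
  proof -
    \<comment> \<open>\<open>q\<close> is measurable on positive times only; \<open>max r s\<close>
      stays positive and equals r wherever the indicator of [s, t] does not vanish.\<close>
    have 1: "(\<lambda>(r, y). (max r s, x, y)) \<in> borel \<Otimes>\<^sub>M borel \<rightarrow>\<^sub>M
        restrict_space borel ({0<..} \<times> UNIV \<times> (UNIV::real set))"
      using st by (intro measurable_restrict_space2) (auto simp: borel_prod[symmetric] less_max_iff_disj)
    have "(\<lambda>(t, x, y). q t x y) \<in> borel_measurable (restrict_space borel ({0<..} \<times> UNIV \<times> UNIV))"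
      using cond by (simp add: condition_X_def)
    from measurable_compose[OF 1 this]
    have [measurable]: "(\<lambda>(r, y). q (max r s) x y) \<in> borel_measurable (borel \<Otimes>\<^sub>M borel)"
      by (simp add: case_prod_unfold)
    have "Q = (\<lambda>z. indicator {s..t} (fst z) * (case z of (r, y) \<Rightarrow> q (max r s) x y))"
      by (auto simp: Q_def fun_eq_iff indicator_def max_def)
    then show ?thesis by simp
  qed
  have Qnn: "0 \<le> Q z" for z using st qnn by (auto simp: Q_def indicator_def split: prod.split)
  have Qint: "(\<integral>\<^sup>+y. \<integral>\<^sup>+r. ennreal (Q (r, y)) \<partial>lborel \<partial>lborel) = ennreal (t - s)"
  proof -
    have "(\<integral>\<^sup>+y. \<integral>\<^sup>+r. ennreal (Q (r, y)) \<partial>lborel \<partial>lborel)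
        = (\<integral>\<^sup>+r. \<integral>\<^sup>+y. ennreal (Q (r, y)) \<partial>lborel \<partial>lborel)"
      by (rule lborel_pair.Fubini) simp
    also have "\<dots> = (\<integral>\<^sup>+r. indicator {s..t} r \<partial>lborel)"
    proof (rule nn_integral_cong)
      fix r
      show "(\<integral>\<^sup>+y. ennreal (Q (r, y)) \<partial>lborel) = indicator {s..t} r"
        using qd[of r x] st by (cases "r \<in> {s..t}") (auto simp: Q_def prob_density_def)
    qed
    also have "\<dots> = ennreal (t - s)" using st by simp
    finally show ?thesis .
  qed
  \<comment> \<open>The double integral is t - s, so for almost every y the section of
    \<open>Q\<close> at y has a finite integral and can serve as a majorant.\<close>
  have "AE y in lborel. (\<integral>\<^sup>+r. ennreal (Q (r, y)) \<partial>lborel) \<noteq> \<infinity>"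
    by (rule nn_integral_PInf_AE) (auto simp: Qint)
  then have "AE y in lborel. ennreal \<bar>p t x y - p s x y\<bar>
      \<le> ennreal (CT / s) * (\<integral>\<^sup>+r. ennreal (Q (r, y)) \<partial>lborel)"
  proof eventually_elim
    case (elim y)
    have Qi: "integrable lborel (\<lambda>r. Q (r, y))"
      using elim Qnn by (intro integrableI_nonneg) (auto simp: less_top)
    have qi: "set_integrable lborel {s..t} (\<lambda>r. CT / s * q r x y)"
      using integrable_mult_right[OF Qi, of "CT / s"]
      by (auto simp: set_integrable_def Q_def algebra_simps)
    have qv: "(LINT r:{s..t}|lborel. CT / s * q r x y) = CT / s * (\<integral>r. Q (r, y) \<partial>lborel)"
      by (auto simp: set_lebesgue_integral_def Q_def simp flip: integral_mult_right_zero
          intro!: Bochner_Integration.integral_cong)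
    \<comment> \<open>The derivative is known to exist pointwise but not to be continuous in time,
      so the fundamental theorem is applied to the gauge integral; the majorant alone is read back
      as a Lebesgue integral.\<close>
    have ftc: "((\<lambda>r. deriv (\<lambda>s. p s x y) r) has_integral (p t x y - p s x y)) {s..t}"
    proof (rule fundamental_theorem_of_calculus)
      fix r assume "r \<in> {s..t}"
      then have "(\<lambda>s. p s x y) differentiable (at r)" using st diff by auto
      then have "((\<lambda>s. p s x y) has_real_derivative deriv (\<lambda>s. p s x y) r) (at r)"
        using DERIV_deriv_iff_real_differentiable by blast
      then show "((\<lambda>s. p s x y) has_vector_derivative deriv (\<lambda>s. p s x y) r) (at r within {s..t})"
        using has_real_derivative_iff_has_vector_derivative has_vector_derivative_at_within by blast
    qed (use st in auto)
    have "norm (integral {s..t} (\<lambda>r. deriv (\<lambda>s. p s x y) r))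
        \<le> integral {s..t} (\<lambda>r. CT / s * q r x y)"
    proof (rule Henstock_Kurzweil_Integration.integral_norm_bound_integral)
      show "(\<lambda>r. deriv (\<lambda>s. p s x y) r) integrable_on {s..t}" using ftc by blast
      show "(\<lambda>r. CT / s * q r x y) integrable_on {s..t}"
        using set_borel_integral_eq_integral(1)[OF qi] .
      fix r assume r: "r \<in> {s..t}"
      have "norm (deriv (\<lambda>s. p s x y) r) \<le> CT * inverse r * q r x y"
        using bound[of r x y] r st by auto
      also have "\<dots> \<le> CT / s * q r x y"
        using r st C qnn[of r x y] by (intro mult_right_mono) (auto simp: divide_inverse)
      finally show "norm (deriv (\<lambda>s. p s x y) r) \<le> CT / s * q r x y" .
    qed
    then have "\<bar>p t x y - p s x y\<bar> \<le> CT / s * (\<integral>r. Q (r, y) \<partial>lborel)"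
      unfolding integral_unique[OF ftc] set_borel_integral_eq_integral(2)[OF qi, symmetric] qv by simp
    then have "ennreal \<bar>p t x y - p s x y\<bar> \<le> ennreal (CT / s) * ennreal (\<integral>r. Q (r, y) \<partial>lborel)"
      using C st Qnn by (simp flip: ennreal_mult)
    also have "ennreal (\<integral>r. Q (r, y) \<partial>lborel) = (\<integral>\<^sup>+r. ennreal (Q (r, y)) \<partial>lborel)"
      using Qnn by (intro nn_integral_eq_integral[symmetric] Qi) auto
    finally show ?case .
  qed
  then have "(\<integral>\<^sup>+y. ennreal \<bar>p t x y - p s x y\<bar> \<partial>lborel)
      \<le> (\<integral>\<^sup>+y. ennreal (CT / s) * (\<integral>\<^sup>+r. ennreal (Q (r, y)) \<partial>lborel) \<partial>lborel)"
    by (rule nn_integral_mono_AE)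
  also have "\<dots> = ennreal (CT / s) * ennreal (t - s)"
    by (subst nn_integral_cmult) (auto simp: Qint)
  also have "\<dots> = ennreal (CT * (t - s) / s)"
    using C st by (simp flip: ennreal_mult)
  finally show ?thesis .
qed

text \<open>The sup bound of \<open>g\<close> is multiplied by the L^1 distance of the two
  densities.\<close>

lemma transition_increment:
  assumes cond: "condition_X p q T CT" and pd: "prob_density (p s x)" "prob_density (p t x)"
    and st: "0 < s" "s \<le> t" "t \<le> T"
    and g: "g \<in> borel_measurable borel" "\<And>y. \<bar>g y\<bar> \<le> d"
  shows "\<bar>transition p t g x - transition p s g x\<bar> \<le> d * (CT * (t - s) / s)"
proof (cases "s = t")
  case False
  then have st': "s < t" using st by simp
  have C: "CT \<ge> 1" using cond by (simp add: condition_X_def)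
  have d: "d \<ge> 0" using g(2)[of 0] by linarith
  have i: "integrable lborel (\<lambda>y. \<bar>p t x y - p s x y\<bar>)"
    using prob_density_integral(1)[OF pd(1)] prob_density_integral(1)[OF pd(2)] by simp
  have "ennreal (\<integral>y. \<bar>p t x y - p s x y\<bar> \<partial>lborel) = (\<integral>\<^sup>+y. ennreal \<bar>p t x y - p s x y\<bar> \<partial>lborel)"
    by (rule nn_integral_eq_integral[symmetric]) (use i in auto)
  also have "\<dots> \<le> ennreal (CT * (t - s) / s)"
    by (rule condition_X_increment_nn) (use cond st st' in auto)
  finally have v: "(\<integral>y. \<bar>p t x y - p s x y\<bar> \<partial>lborel) \<le> CT * (t - s) / s"
    using C st by (simp add: ennreal_le_iff)
  have ig: "integrable lborel (\<lambda>y. p s x y * g y)" "integrable lborel (\<lambda>y. p t x y * g y)"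
    using prob_density_integrable_mult[OF pd(1) g] prob_density_integrable_mult[OF pd(2) g] by auto
  have "\<bar>transition p t g x - transition p s g x\<bar> = \<bar>\<integral>y. p t x y * g y - p s x y * g y \<partial>lborel\<bar>"
    using ig by (simp add: transition_def)
  also have "\<dots> \<le> (\<integral>y. \<bar>p t x y * g y - p s x y * g y\<bar> \<partial>lborel)"
    by (rule integral_abs_bound)
  also have "\<dots> \<le> (\<integral>y. d * \<bar>p t x y - p s x y\<bar> \<partial>lborel)"
  proof (rule integral_mono)
    show "integrable lborel (\<lambda>y. \<bar>p t x y * g y - p s x y * g y\<bar>)" using ig by simp
    show "integrable lborel (\<lambda>y. d * \<bar>p t x y - p s x y\<bar>)" using i by simp
    fix y
    show "\<bar>p t x y * g y - p s x y * g y\<bar> \<le> d * \<bar>p t x y - p s x y\<bar>"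
      using mult_left_mono[OF g(2)[of y], of "\<bar>p t x y - p s x y\<bar>"]
      by (simp add: abs_mult[symmetric] algebra_simps)
  qed
  also have "\<dots> \<le> d * (CT * (t - s) / s)"
    unfolding integral_mult_right_zero using v d by (rule mult_left_mono)
  finally show ?thesis .
qed (simp add: transition_def)

section \<open>The Markov property for bounded functions\<close>

locale markov_density = prob_space M for M :: "'w measure" +
  fixes X :: "real \<Rightarrow> 'w \<Rightarrow> real" and p :: "real \<Rightarrow> real \<Rightarrow> real \<Rightarrow> real"
  assumes markov: "markov_process_with_density M X p"
begin

abbreviation "F \<equiv> natural_filtration M X"

lemma density_prob: "t > 0 \<Longrightarrow> prob_density (p t x)"
  and density_measurable: "t > 0 \<Longrightarrow> (\<lambda>(x, y). p t x y) \<in> borel_measurable (borel \<Otimes>\<^sub>M borel)"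
  using markov by (auto simp: markov_process_with_density_def borel_prod)

text \<open>Freezing the trajectory at its initial value for negative times extends joint
  measurability to the whole line, where Fubini with \<open>lborel\<close> applies directly.\<close>

lemma X_measurable_joint: "(\<lambda>(t, \<omega>). X (max 0 t) \<omega>) \<in> borel_measurable (borel \<Otimes>\<^sub>M M)"
proof -
  have "(\<lambda>(t, \<omega>). (max 0 t, \<omega>)) \<in> borel \<Otimes>\<^sub>M M \<rightarrow>\<^sub>M restrict_space borel {0::real..} \<Otimes>\<^sub>M M"
    unfolding case_prod_unfold
    by (intro measurable_Pair measurable_restrict_space2) auto
  moreover have "(\<lambda>(t, \<omega>). X t \<omega>) \<in> borel_measurable (restrict_space borel {0..} \<Otimes>\<^sub>M M)"
    using markov by (simp add: markov_process_with_density_def measurable_process_def)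
  ultimately have "(\<lambda>z. (\<lambda>(t, \<omega>). X t \<omega>) ((\<lambda>(t, \<omega>). (max 0 t, \<omega>)) z)) \<in> borel_measurable (borel \<Otimes>\<^sub>M M)"
    by (rule measurable_compose)
  then show ?thesis by (simp add: case_prod_unfold)
qed

lemma X_measurable:
  assumes "t \<ge> 0" shows "X t \<in> borel_measurable M"
proof -
  have "(\<lambda>\<omega>. (case (t, \<omega>) of (t, \<omega>) \<Rightarrow> X (max 0 t) \<omega>)) \<in> borel_measurable M"
    by (rule measurable_compose[OF _ X_measurable_joint]) simp
  then show ?thesis using assms by simp
qed

lemma space_F: "space (F s) = space M"
  and sets_F: "sets (F s) = sigma_sets (space M) {X v -` A \<inter> space M | v A. v \<in> {0..s} \<and> A \<in> sets borel}"
  by (auto simp: natural_filtration_def intro!: space_measure_of sets_measure_of)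

lemma F_subalgebra: "subalgebra M (F s)"
  unfolding subalgebra_def space_F sets_F
  by (auto intro!: sets.sigma_sets_subset X_measurable measurable_sets)

lemma X_F_measurable: "0 \<le> v \<Longrightarrow> v \<le> s \<Longrightarrow> X v \<in> borel_measurable (F s)"
  by (rule measurableI) (auto simp: space_F sets_F)

lemma F_mono: "s \<le> t \<Longrightarrow> f \<in> borel_measurable (F s) \<Longrightarrow> f \<in> borel_measurable (F t)"
proof (rule measurable_from_subalg)
  assume "s \<le> t"
  then show "subalgebra (F t) (F s)"
    unfolding subalgebra_def space_F sets_F by (fastforce intro!: sigma_sets_mono')
qed

lemma F_sigma_finite: "sigma_finite_subalgebra M (F s)"
  by (rule finite_measure_subalgebra_is_sigma_finite)
    (simp add: finite_measure_subalgebra_def finite_measure_subalgebra_axioms_def F_subalgebra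
      finite_measure_axioms)

lemma F_measurable_M: "f \<in> borel_measurable (F s) \<Longrightarrow> f \<in> borel_measurable M"
  using measurable_from_subalg[OF F_subalgebra] by blast

text \<open>The Markov assumption concerns indicators of sets; testing it against an
  \<open>F s\<close>-measurable \<open>Y\<close> is the defining property of conditional
  expectation. The result is put into extended nonnegative integrals so that it passes to monotone
  limits in \<open>markov_nn\<close>.\<close>

lemma markov_indicator:
  assumes s: "0 \<le> s" "s < t" and Y: "Y \<in> borel_measurable (F s)" "\<And>\<omega>. 0 \<le> Y \<omega>" "\<And>\<omega>. Y \<omega> \<le> c"
    and A: "A \<in> sets borel"
  shows "(\<integral>\<^sup>+\<omega>. ennreal (Y \<omega>) * indicator A (X t \<omega>) \<partial>M)
      = (\<integral>\<^sup>+\<omega>. ennreal (Y \<omega>) * (\<integral>\<^sup>+y. ennreal (p (t - s) (X s \<omega>) y) * indicator A y \<partial>lborel) \<partial>M)"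
proof -
  interpret sigma_finite_subalgebra M "F s" by (rule F_sigma_finite)
  have [measurable]: "X t \<in> borel_measurable M" "X s \<in> borel_measurable M" "Y \<in> borel_measurable M"
    using X_measurable s F_measurable_M Y by auto
  note A[measurable]
  define k where "k \<omega> = (LBINT y:A. p (t - s) (X s \<omega>) y)" for \<omega>
  have pd: "prob_density (p (t - s) x)" for x using density_prob s by simp
  have kAE: "AE \<omega> in M. real_cond_exp M (F s) (\<lambda>\<omega>'. indicator A (X t \<omega>')) \<omega> = k \<omega>"
    using markov s A unfolding markov_process_with_density_def k_def by auto
  have k': "k \<omega> = (\<integral>y. p (t - s) (X s \<omega>) y * indicator A y \<partial>lborel)" for \<omega>
    by (simp add: k_def set_lebesgue_integral_def mult.commute)
  have k0: "0 \<le> k \<omega>" for \<omega>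
    unfolding k' using pd[of "X s \<omega>"] by (intro integral_nonneg_AE) (auto simp: prob_density_def)
  have kn: "ennreal (k \<omega>) = (\<integral>\<^sup>+y. ennreal (p (t - s) (X s \<omega>) y) * indicator A y \<partial>lborel)" for \<omega>
  proof -
    have "ennreal (k \<omega>) = (\<integral>\<^sup>+y. ennreal (p (t - s) (X s \<omega>) y * indicator A y) \<partial>lborel)"
      unfolding k' using pd[of "X s \<omega>"]
      by (intro nn_integral_eq_integral[symmetric] prob_density_integrable_mult[where d=1])
        (auto simp: prob_density_def indicator_def)
    also have "\<dots> = (\<integral>\<^sup>+y. ennreal (p (t - s) (X s \<omega>) y) * indicator A y \<partial>lborel)"
      by (intro nn_integral_cong) (auto simp: indicator_def)
    finally show ?thesis .
  qed
  have i: "integrable M (\<lambda>\<omega>. Y \<omega> * indicator A (X t \<omega>))"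
    using Y by (intro integrable_const_bound[where B=c]) (auto simp: indicator_def intro: order_trans)
  have "(\<integral>\<^sup>+\<omega>. ennreal (Y \<omega>) * indicator A (X t \<omega>) \<partial>M)
      = (\<integral>\<^sup>+\<omega>. ennreal (Y \<omega> * indicator A (X t \<omega>)) \<partial>M)"
    by (intro nn_integral_cong) (auto simp: indicator_def)
  also have "\<dots> = ennreal (\<integral>\<omega>. Y \<omega> * indicator A (X t \<omega>) \<partial>M)"
    using Y(2) by (intro nn_integral_eq_integral i) auto
  also have "(\<integral>\<omega>. Y \<omega> * indicator A (X t \<omega>) \<partial>M)
      = (\<integral>\<omega>. Y \<omega> * real_cond_exp M (F s) (\<lambda>\<omega>'. indicator A (X t \<omega>')) \<omega> \<partial>M)"
    by (rule real_cond_exp_intg(2)[symmetric]) (use i Y in auto)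
  also have "ennreal \<dots> = (\<integral>\<^sup>+\<omega>. ennreal (Y \<omega> * real_cond_exp M (F s) (\<lambda>\<omega>'. indicator A (X t \<omega>')) \<omega>) \<partial>M)"
  proof (rule nn_integral_eq_integral[symmetric])
    show "integrable M (\<lambda>\<omega>. Y \<omega> * real_cond_exp M (F s) (\<lambda>\<omega>'. indicator A (X t \<omega>')) \<omega>)"
      by (rule real_cond_exp_intg(1)) (use i Y in auto)
    show "AE \<omega> in M. 0 \<le> Y \<omega> * real_cond_exp M (F s) (\<lambda>\<omega>'. indicator A (X t \<omega>')) \<omega>"
      using kAE by eventually_elim (use k0 Y(2) in auto)
  qed
  also have "\<dots> = (\<integral>\<^sup>+\<omega>. ennreal (Y \<omega>) * ennreal (k \<omega>) \<partial>M)"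
  proof (rule nn_integral_cong_AE)
    show "AE \<omega> in M. ennreal (Y \<omega> * real_cond_exp M (F s) (\<lambda>\<omega>'. indicator A (X t \<omega>')) \<omega>)
        = ennreal (Y \<omega>) * ennreal (k \<omega>)"
      using kAE by eventually_elim (use k0 Y(2) in \<open>simp add: ennreal_mult\<close>)
  qed
  finally show ?thesis by (simp add: kn)
qed

lemma transition_nn_measurable:
  assumes "t > 0" "g \<in> borel_measurable borel"
  shows "(\<lambda>x. \<integral>\<^sup>+y. ennreal (p t x y) * g y \<partial>lborel) \<in> borel_measurable borel"
proof -
  note [measurable] = density_measurable[OF assms(1)] assms(2)
  show ?thesis by measurable
qed

text \<open>Indicators extend to nonnegative functions through scaling, sums and monotone limits,
  under which all the integrals involved are additive and continuous from below.\<close>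

lemma markov_nn:
  assumes s: "0 \<le> s" "s < t" and Y: "Y \<in> borel_measurable (F s)" "\<And>\<omega>. 0 \<le> Y \<omega>" "\<And>\<omega>. Y \<omega> \<le> c"
    and g: "g \<in> borel_measurable borel"
  shows "(\<integral>\<^sup>+\<omega>. ennreal (Y \<omega>) * g (X t \<omega>) \<partial>M)
      = (\<integral>\<^sup>+\<omega>. ennreal (Y \<omega>) * (\<integral>\<^sup>+y. ennreal (p (t - s) (X s \<omega>) y) * g y \<partial>lborel) \<partial>M)"
  using g
proof induction
  have [measurable]: "X t \<in> borel_measurable M" "X s \<in> borel_measurable M" "Y \<in> borel_measurable M"
    using X_measurable s F_measurable_M Y by auto
  have pm[measurable]: "(\<lambda>y. p (t - s) x y) \<in> borel_measurable borel" for x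
    using density_prob[of "t - s" x] s by (simp add: prob_density_def)
  have Pm[measurable]: "(\<lambda>\<omega>. \<integral>\<^sup>+y. ennreal (p (t - s) (X s \<omega>) y) * g y \<partial>lborel) \<in> borel_measurable M"
    if "g \<in> borel_measurable borel" for g
    by (rule measurable_compose[OF _ transition_nn_measurable]) (use that s in auto)
  {
    case (cong f g)
    then show ?case by (simp cong: nn_integral_cong)
  next
    case (set A)
    then show ?case using markov_indicator[OF s Y] by simp
  next
    case (mult u a)
    then have [measurable]: "u \<in> borel_measurable borel" by simp
    have "(\<integral>\<^sup>+\<omega>. ennreal (Y \<omega>) * (a * u (X t \<omega>)) \<partial>M) = a * (\<integral>\<^sup>+\<omega>. ennreal (Y \<omega>) * u (X t \<omega>) \<partial>M)"
      by (subst nn_integral_cmult[symmetric]) (auto simp: ac_simps)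
    also have "\<dots> = a * (\<integral>\<^sup>+\<omega>. ennreal (Y \<omega>) * (\<integral>\<^sup>+y. ennreal (p (t - s) (X s \<omega>) y) * u y \<partial>lborel) \<partial>M)"
      using mult by simp
    also have "\<dots> = (\<integral>\<^sup>+\<omega>. ennreal (Y \<omega>) * (\<integral>\<^sup>+y. ennreal (p (t - s) (X s \<omega>) y) * (a * u y) \<partial>lborel) \<partial>M)"
    proof -
      have "(\<integral>\<^sup>+y. ennreal (p (t - s) x y) * (a * u y) \<partial>lborel)
          = a * (\<integral>\<^sup>+y. ennreal (p (t - s) x y) * u y \<partial>lborel)" for x
        by (subst nn_integral_cmult[symmetric]) (auto simp: ac_simps)
      then show ?thesis
        by (subst nn_integral_cmult[symmetric]) (auto simp: mult.left_commute)
    qed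
    finally show ?case .
  next
    case (add u v)
    then have [measurable]: "u \<in> borel_measurable borel" "v \<in> borel_measurable borel" by simp_all
    show ?case using add
      by (simp add: distrib_left nn_integral_add)
  next
    case (seq U)
    then have [measurable]: "\<And>i. U i \<in> borel_measurable borel" by simp
    have mono: "\<And>i j y. i \<le> j \<Longrightarrow> U i y \<le> U j y" using \<open>incseq U\<close> by (auto simp: incseq_def le_fun_def)
    have "(\<integral>\<^sup>+\<omega>. ennreal (Y \<omega>) * (SUP i. U i) (X t \<omega>) \<partial>M)
        = (SUP i. \<integral>\<^sup>+\<omega>. ennreal (Y \<omega>) * U i (X t \<omega>) \<partial>M)"
      by (subst nn_integral_monotone_convergence_SUP[symmetric])
        (auto simp: incseq_def le_fun_def SUP_mult_left_ennreal image_comp intro!: mult_left_mono mono)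
    also have "\<dots> = (SUP i. \<integral>\<^sup>+\<omega>. ennreal (Y \<omega>) * (\<integral>\<^sup>+y. ennreal (p (t - s) (X s \<omega>) y) * U i y \<partial>lborel) \<partial>M)"
      using seq by simp
    also have "\<dots> = (\<integral>\<^sup>+\<omega>. (SUP i. ennreal (Y \<omega>) * (\<integral>\<^sup>+y. ennreal (p (t - s) (X s \<omega>) y) * U i y \<partial>lborel)) \<partial>M)"
      by (subst nn_integral_monotone_convergence_SUP[symmetric])
        (auto simp: incseq_def le_fun_def intro!: mult_left_mono nn_integral_mono mono)
    also have "\<dots> = (\<integral>\<^sup>+\<omega>. ennreal (Y \<omega>) * (\<integral>\<^sup>+y. ennreal (p (t - s) (X s \<omega>) y) * (SUP i. U i) y \<partial>lborel) \<partial>M)"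
    proof (rule nn_integral_cong)
      fix \<omega>
      have "(\<integral>\<^sup>+y. ennreal (p (t - s) (X s \<omega>) y) * (SUP i. U i) y \<partial>lborel)
          = (SUP i. \<integral>\<^sup>+y. ennreal (p (t - s) (X s \<omega>) y) * U i y \<partial>lborel)"
        by (subst nn_integral_monotone_convergence_SUP[symmetric])
          (auto simp: incseq_def le_fun_def SUP_mult_left_ennreal image_comp intro!: mult_left_mono mono)
      then show "(SUP i. ennreal (Y \<omega>) * (\<integral>\<^sup>+y. ennreal (p (t - s) (X s \<omega>) y) * U i y \<partial>lborel))
          = ennreal (Y \<omega>) * (\<integral>\<^sup>+y. ennreal (p (t - s) (X s \<omega>) y) * (SUP i. U i) y \<partial>lborel)"
        by (simp add: SUP_mult_left_ennreal)
    qed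
    finally show ?case .
  }
qed

lemma transition_measurable:
  assumes "t > 0" "g \<in> borel_measurable borel"
  shows "transition p t g \<in> borel_measurable borel"
proof -
  note [measurable] = density_measurable[OF assms(1)] assms(2)
  show ?thesis unfolding transition_def by measurable
qed

lemma transition_bound:
  assumes "t > 0" "g \<in> borel_measurable borel" "\<And>y. \<bar>g y\<bar> \<le> d"
  shows "\<bar>transition p t g x\<bar> \<le> d"
  unfolding transition_def by (rule prob_density_integral_bound[OF density_prob assms(2,3)]) (rule assms(1))

lemma transition_add_const:
  assumes "t > 0" "g \<in> borel_measurable borel" "\<And>y. \<bar>g y\<bar> \<le> d"
  shows "transition p t (\<lambda>y. g y + a) x = transition p t g x + a"
proof -
  note pd = density_prob[OF assms(1), of x]
  show ?thesis
    using prob_density_integrable_mult[OF pd assms(2,3)] prob_density_integral[OF pd]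
    by (simp add: transition_def distrib_left)
qed

lemma integrable_bounded:
  fixes Y :: "'w \<Rightarrow> real"
  assumes "Y \<in> borel_measurable M" "\<And>\<omega>. \<bar>Y \<omega>\<bar> \<le> c"
  shows "integrable M Y"
  using assms by (intro integrable_const_bound[where B=c]) auto

lemma markov_nonneg:
  assumes s: "0 \<le> s" "s < t" and Y: "Y \<in> borel_measurable (F s)" "\<And>\<omega>. 0 \<le> Y \<omega>" "\<And>\<omega>. Y \<omega> \<le> c"
    and g: "g \<in> borel_measurable borel" "\<And>y. 0 \<le> g y" "\<And>y. g y \<le> d"
  shows "(\<integral>\<omega>. Y \<omega> * g (X t \<omega>) \<partial>M) = (\<integral>\<omega>. Y \<omega> * transition p (t - s) g (X s \<omega>) \<partial>M)"
proof -
  have [measurable]: "X t \<in> borel_measurable M" "X s \<in> borel_measurable M" "Y \<in> borel_measurable M"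
    using X_measurable s F_measurable_M Y by auto
  have tm[measurable]: "transition p (t - s) g \<in> borel_measurable borel"
    using s g by (intro transition_measurable) auto
  note g(1)[measurable]
  have pd: "prob_density (p (t - s) x)" for x using density_prob s by simp
  have gd: "\<bar>g y\<bar> \<le> d" for y using g by (simp add: abs_of_nonneg)
  have t0: "0 \<le> transition p (t - s) g x" for x
    unfolding transition_def using pd[of x] g by (intro integral_nonneg_AE) (auto simp: prob_density_def)
  have tn: "(\<integral>\<^sup>+y. ennreal (p (t - s) x y) * ennreal (g y) \<partial>lborel) = ennreal (transition p (t - s) g x)" for x
  proof -
    have "ennreal (transition p (t - s) g x) = (\<integral>\<^sup>+y. ennreal (p (t - s) x y * g y) \<partial>lborel)"
      unfolding transition_def using pd[of x] g
      by (intro nn_integral_eq_integral[symmetric] prob_density_integrable_mult[OF _ _ gd])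
        (auto simp: prob_density_def)
    also have "\<dots> = (\<integral>\<^sup>+y. ennreal (p (t - s) x y) * ennreal (g y) \<partial>lborel)"
      using pd[of x] g by (intro nn_integral_cong ennreal_mult) (auto simp: prob_density_def)
    finally show ?thesis by simp
  qed
  have Yc: "\<bar>Y \<omega>\<bar> \<le> c" for \<omega> using Y by (simp add: abs_of_nonneg)
  have "ennreal (\<integral>\<omega>. Y \<omega> * g (X t \<omega>) \<partial>M) = (\<integral>\<^sup>+\<omega>. ennreal (Y \<omega> * g (X t \<omega>)) \<partial>M)"
    using Y(2) g by (intro nn_integral_eq_integral[symmetric] integrable_bounded[where c="c * d"] abs_mult_le Yc gd) auto
  also have "\<dots> = (\<integral>\<^sup>+\<omega>. ennreal (Y \<omega>) * ennreal (g (X t \<omega>)) \<partial>M)"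
    using Y(2) g by (simp add: ennreal_mult)
  also have "\<dots> = (\<integral>\<^sup>+\<omega>. ennreal (Y \<omega>) * ennreal (transition p (t - s) g (X s \<omega>)) \<partial>M)"
    using markov_nn[OF s Y, of "\<lambda>y. ennreal (g y)"] by (simp add: tn)
  also have "\<dots> = (\<integral>\<^sup>+\<omega>. ennreal (Y \<omega> * transition p (t - s) g (X s \<omega>)) \<partial>M)"
    using Y(2) t0 by (simp add: ennreal_mult)
  also have "\<dots> = ennreal (\<integral>\<omega>. Y \<omega> * transition p (t - s) g (X s \<omega>) \<partial>M)"
    using Y(2) t0 s g
    by (intro nn_integral_eq_integral integrable_bounded[where c="c * d"] abs_mult_le Yc transition_bound gd) auto
  finally have eq: "ennreal (\<integral>\<omega>. Y \<omega> * g (X t \<omega>) \<partial>M)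
      = ennreal (\<integral>\<omega>. Y \<omega> * transition p (t - s) g (X s \<omega>) \<partial>M)" .
  have "0 \<le> (\<integral>\<omega>. Y \<omega> * g (X t \<omega>) \<partial>M)" "0 \<le> (\<integral>\<omega>. Y \<omega> * transition p (t - s) g (X s \<omega>) \<partial>M)"
    using Y(2) g(2) t0 by (auto intro!: Bochner_Integration.integral_nonneg mult_nonneg_nonneg)
  with eq show ?thesis using ennreal_inj by blast
qed

section \<open>Adaptedness up to null sets\<close>

text \<open>The filtration is not completed by null sets, while the occupation time will only be
  shown to agree almost surely with an adapted variable. Measurability for \<open>M\<close> is
  demanded separately because \<open>M\<close> need not be complete.\<close>

definition adapted_ae :: "real \<Rightarrow> ('w \<Rightarrow> real) \<Rightarrow> bool" where
  "adapted_ae s Y \<longleftrightarrow> Y \<in> borel_measurable M \<and> (\<exists>Y'\<in>borel_measurable (F s). AE \<omega> in M. Y \<omega> = Y' \<omega>)"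

lemma adapted_aeE:
  assumes "adapted_ae s Y"
  obtains Y' where "Y' \<in> borel_measurable (F s)" "AE \<omega> in M. Y \<omega> = Y' \<omega>"
  using assms unfolding adapted_ae_def by blast

lemma adapted_ae_measurable: "adapted_ae s Y \<Longrightarrow> Y \<in> borel_measurable M"
  by (simp add: adapted_ae_def)

lemma adapted_ae_mono: "adapted_ae s Y \<Longrightarrow> s \<le> t \<Longrightarrow> adapted_ae t Y"
  unfolding adapted_ae_def using F_mono by fast

lemma adapted_ae_X: "0 \<le> v \<Longrightarrow> v \<le> s \<Longrightarrow> g \<in> borel_measurable borel \<Longrightarrow> adapted_ae s (\<lambda>\<omega>. g (X v \<omega>))"
  unfolding adapted_ae_def
  by (intro conjI bexI[of _ "\<lambda>\<omega>. g (X v \<omega>)"] AE_I2 refl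
      measurable_compose[OF X_F_measurable] measurable_compose[OF X_measurable])

lemma adapted_ae_const: "adapted_ae s (\<lambda>_. a)"
  unfolding adapted_ae_def by (intro conjI bexI[of _ "\<lambda>_. a"] AE_I2) simp_all

lemma adapted_ae_compose2:
  assumes "adapted_ae s Y" "adapted_ae s Z" "case_prod \<phi> \<in> borel_measurable (borel \<Otimes>\<^sub>M borel)"
  shows "adapted_ae s (\<lambda>\<omega>. \<phi> (Y \<omega>) (Z \<omega>))"
proof -
  note [measurable] = assms(1,2)[THEN adapted_ae_measurable]
  obtain Y' where [measurable]: "Y' \<in> borel_measurable (F s)" and aeY: "AE \<omega> in M. Y \<omega> = Y' \<omega>"
    using assms(1) by (rule adapted_aeE)
  obtain Z' where [measurable]: "Z' \<in> borel_measurable (F s)" and aeZ: "AE \<omega> in M. Z \<omega> = Z' \<omega>"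
    using assms(2) by (rule adapted_aeE)
  note assms(3)[measurable]
  have "AE \<omega> in M. \<phi> (Y \<omega>) (Z \<omega>) = \<phi> (Y' \<omega>) (Z' \<omega>)"
    using aeY aeZ by eventually_elim simp
  then show ?thesis
    unfolding adapted_ae_def by (intro conjI bexI[of _ "\<lambda>\<omega>. \<phi> (Y' \<omega>) (Z' \<omega>)"]) measurable
qed

lemma adapted_ae_mult: "adapted_ae s Y \<Longrightarrow> adapted_ae s Z \<Longrightarrow> adapted_ae s (\<lambda>\<omega>. Y \<omega> * Z \<omega>)"
  by (rule adapted_ae_compose2) auto

lemma adapted_ae_diff: "adapted_ae s Y \<Longrightarrow> adapted_ae s Z \<Longrightarrow> adapted_ae s (\<lambda>\<omega>. Y \<omega> - Z \<omega>)"
  by (rule adapted_ae_compose2) auto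

lemma adapted_ae_compose:
  "adapted_ae s Y \<Longrightarrow> \<phi> \<in> borel_measurable borel \<Longrightarrow> adapted_ae s (\<lambda>\<omega>. \<phi> (Y \<omega>))"
  by (rule adapted_ae_compose2[where \<phi>="\<lambda>a _. \<phi> a", OF _ adapted_ae_const]) auto

text \<open>Adding constants makes both factors nonnegative and reduces the claim to
  \<open>markov_nonneg\<close>; the constants can be removed again because a transition preserves
  them.\<close>

lemma markov_bounded:
  assumes s: "0 \<le> s" "s < t" and Y: "adapted_ae s Y" "\<And>\<omega>. \<bar>Y \<omega>\<bar> \<le> c"
    and g: "g \<in> borel_measurable borel" "\<And>y. \<bar>g y\<bar> \<le> d"
  shows "(\<integral>\<omega>. Y \<omega> * g (X t \<omega>) \<partial>M) = (\<integral>\<omega>. Y \<omega> * transition p (t - s) g (X s \<omega>) \<partial>M)"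
proof -
  have [measurable]: "X t \<in> borel_measurable M" "X s \<in> borel_measurable M"
    using X_measurable s by auto
  have ts: "t - s > 0" using s by simp
  have tm[measurable]: "transition p (t - s) g \<in> borel_measurable borel"
    using s g by (intro transition_measurable) auto
  note g(1)[measurable]
  note tb = transition_bound[OF ts g]
  have nonneg: "(\<integral>\<omega>. Z \<omega> * g (X t \<omega>) \<partial>M) = (\<integral>\<omega>. Z \<omega> * transition p (t - s) g (X s \<omega>) \<partial>M)"
    if Z: "Z \<in> borel_measurable (F s)" "\<And>\<omega>. 0 \<le> Z \<omega>" "\<And>\<omega>. Z \<omega> \<le> c'" for Z c'
  proof -
    have Zm[measurable]: "Z \<in> borel_measurable M" using F_measurable_M Z by auto
    have Zc: "\<bar>Z \<omega>\<bar> \<le> c'" for \<omega> using Z by (simp add: abs_of_nonneg)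
    have i: "integrable M (\<lambda>\<omega>. Z \<omega> * g (X t \<omega>))" "integrable M Z"
        "integrable M (\<lambda>\<omega>. Z \<omega> * transition p (t - s) g (X s \<omega>))"
      by (auto intro!: integrable_bounded[where c="c' * d", OF _ abs_mult_le]
          integrable_bounded[where c=c', OF _ Zc] Zc g tb)
    have "(\<integral>\<omega>. Z \<omega> * (g (X t \<omega>) + d) \<partial>M) = (\<integral>\<omega>. Z \<omega> * transition p (t - s) (\<lambda>y. g y + d) (X s \<omega>) \<partial>M)"
    proof (rule markov_nonneg[OF s Z])
      show "0 \<le> g y + d" "g y + d \<le> 2 * d" for y using g(2)[of y] by (simp_all add: abs_le_iff)
    qed auto
    then show ?thesis
      unfolding transition_add_const[OF ts g] using i by (simp add: distrib_left)
  qed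
  note [measurable] = adapted_ae_measurable[OF Y(1)]
  obtain Y' where [measurable]: "Y' \<in> borel_measurable (F s)" and ae: "AE \<omega> in M. Y \<omega> = Y' \<omega>"
    using Y(1) by (rule adapted_aeE)
  have c: "c \<ge> 0" using Y(2)[of undefined] by linarith
  \<comment> \<open>The bound on \<open>Y\<close> may fail for its version \<open>Y'\<close> on a
    null set. Clipping \<open>Y' + c\<close> to [0, 2c] restores it everywhere and changes nothing
    almost surely.\<close>
  define Z where "Z \<omega> = min (2 * c) (max 0 (Y' \<omega> + c))" for \<omega>
  have Z: "Z \<in> borel_measurable (F s)" "\<And>\<omega>. 0 \<le> Z \<omega>" "\<And>\<omega>. Z \<omega> \<le> 2 * c"
    unfolding Z_def[abs_def] using c by simp_all
  have [measurable]: "Z \<in> borel_measurable M" using F_measurable_M Z by auto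
  have YZ: "AE \<omega> in M. Y \<omega> = Z \<omega> - c"
    using ae
  proof eventually_elim
    case (elim \<omega>)
    then show ?case using Y(2)[of \<omega>] by (auto simp: Z_def abs_le_iff)
  qed
  have Zc: "\<bar>Z \<omega>\<bar> \<le> 2 * c" for \<omega> using Z by (simp add: abs_of_nonneg)
  have i: "integrable M (\<lambda>\<omega>. Z \<omega> * g (X t \<omega>))" "integrable M (\<lambda>\<omega>. g (X t \<omega>))"
      "integrable M (\<lambda>\<omega>. Z \<omega> * transition p (t - s) g (X s \<omega>))"
      "integrable M (\<lambda>\<omega>. transition p (t - s) g (X s \<omega>))"
    by (auto intro!: integrable_bounded[where c="2 * c * d", OF _ abs_mult_le]
        integrable_bounded[where c=d, OF _ g(2)] integrable_bounded[where c=d, OF _ tb] Zc g tb)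
  have "(\<integral>\<omega>. Y \<omega> * g (X t \<omega>) \<partial>M) = (\<integral>\<omega>. (Z \<omega> - c) * g (X t \<omega>) \<partial>M)"
    by (rule integral_cong_AE) (use YZ in auto)
  also have "\<dots> = (\<integral>\<omega>. Z \<omega> * g (X t \<omega>) \<partial>M) - c * (\<integral>\<omega>. g (X t \<omega>) \<partial>M)"
    using i by (simp add: left_diff_distrib)
  also have "\<dots> = (\<integral>\<omega>. Z \<omega> * transition p (t - s) g (X s \<omega>) \<partial>M) - c * (\<integral>\<omega>. transition p (t - s) g (X s \<omega>) \<partial>M)"
    using nonneg[OF Z] nonneg[of "\<lambda>_. 1" 1] by simp
  also have "\<dots> = (\<integral>\<omega>. (Z \<omega> - c) * transition p (t - s) g (X s \<omega>) \<partial>M)"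
    using i by (simp add: left_diff_distrib)
  also have "\<dots> = (\<integral>\<omega>. Y \<omega> * transition p (t - s) g (X s \<omega>) \<partial>M)"
    by (rule integral_cong_AE) (use YZ in auto)
  finally show ?thesis .
qed

lemma integral_diff_bound:
  fixes Y Z :: "'w \<Rightarrow> real"
  assumes "integrable M Y" "integrable M Z" "\<And>\<omega>. \<bar>Y \<omega> - Z \<omega>\<bar> \<le> c"
  shows "\<bar>(\<integral>\<omega>. Y \<omega> \<partial>M) - (\<integral>\<omega>. Z \<omega> \<partial>M)\<bar> \<le> c"
proof -
  have "\<bar>(\<integral>\<omega>. Y \<omega> \<partial>M) - (\<integral>\<omega>. Z \<omega> \<partial>M)\<bar> = \<bar>\<integral>\<omega>. Y \<omega> - Z \<omega> \<partial>M\<bar>"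
    using assms by simp
  also have "\<dots> \<le> (\<integral>\<omega>. \<bar>Y \<omega> - Z \<omega>\<bar> \<partial>M)"
    by (rule integral_abs_bound)
  also have "\<dots> \<le> (\<integral>\<omega>. c \<partial>M)"
    using assms by (intro integral_mono) auto
  finally show ?thesis by (simp add: prob_space)
qed

text \<open>The time argument moves in two transitions at once, from \<open>v\<close> to \<open>t\<close> and from \<open>t\<close> to \<open>w\<close>;
  each of the two error terms accounts for one of them.\<close>

lemma smoothing:
  assumes cond: "condition_X p q T CT"
    and time: "0 \<le> v" "v < s" "s \<le> t" "t < w" "w \<le> T"
    and Y: "adapted_ae v Y" "\<And>\<omega>. \<bar>Y \<omega>\<bar> \<le> c"
    and h: "h \<in> borel_measurable borel" "\<And>y. \<bar>h y\<bar> \<le> 1"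
    and g: "g \<in> borel_measurable borel" "\<And>y. \<bar>g y\<bar> \<le> d"
  shows "\<bar>(\<integral>\<omega>. Y \<omega> * h (X t \<omega>) * g (X w \<omega>) \<partial>M) - (\<integral>\<omega>. Y \<omega> * h (X s \<omega>) * g (X w \<omega>) \<partial>M)\<bar>
    \<le> c * d * (CT * (t - s) / (s - v) + CT * (t - s) / (w - t))"
proof -
  \<comment> \<open>\<open>\<psi> r y\<close> is the conditional expectation of h(X_r) g(X_w) given
    X_r = y, so the path after r no longer occurs.\<close>
  define \<psi> where "\<psi> r y = h y * transition p (w - r) g y" for r y
  have [measurable]: "X v \<in> borel_measurable M" "Y \<in> borel_measurable M"
    using X_measurable time adapted_ae_measurable[OF Y(1)] by auto
  have \<psi>m: "\<psi> r \<in> borel_measurable borel" if "r < w" for r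
    using transition_measurable[of "w - r" g] h g that unfolding \<psi>_def by auto
  have \<psi>b: "\<bar>\<psi> r y\<bar> \<le> d" if "r < w" for r y
    using abs_mult_le[OF h(2)[of y] transition_bound[of "w - r" g d y]] g that unfolding \<psi>_def by auto
  have d: "d \<ge> 0" and c: "c \<ge> 0" using g(2)[of undefined] Y(2)[of undefined] by linarith+
  have two_step: "(\<integral>\<omega>. Y \<omega> * h (X r \<omega>) * g (X w \<omega>) \<partial>M) = (\<integral>\<omega>. Y \<omega> * transition p (r - v) (\<psi> r) (X v \<omega>) \<partial>M)"
    if r: "v < r" "r < w" for r
  proof -
    have "(\<integral>\<omega>. Y \<omega> * h (X r \<omega>) * g (X w \<omega>) \<partial>M) = (\<integral>\<omega>. Y \<omega> * h (X r \<omega>) * transition p (w - r) g (X r \<omega>) \<partial>M)"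
    proof (rule markov_bounded[where c="c * 1"])
      show "adapted_ae r (\<lambda>\<omega>. Y \<omega> * h (X r \<omega>))"
        using adapted_ae_mono[OF Y(1)] r time h by (intro adapted_ae_mult adapted_ae_X) auto
      show "\<bar>Y \<omega> * h (X r \<omega>)\<bar> \<le> c * 1" for \<omega> by (intro abs_mult_le Y h)
    qed (use time r g in auto)
    also have "\<dots> = (\<integral>\<omega>. Y \<omega> * \<psi> r (X r \<omega>) \<partial>M)" by (simp add: \<psi>_def mult.assoc)
    also have "\<dots> = (\<integral>\<omega>. Y \<omega> * transition p (r - v) (\<psi> r) (X v \<omega>) \<partial>M)"
      by (rule markov_bounded[OF _ _ Y \<psi>m \<psi>b]) (use time r in auto)
    finally show ?thesis .
  qed
  have split: "\<bar>transition p (t - v) (\<psi> t) x - transition p (s - v) (\<psi> s) x\<bar>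
      \<le> d * (CT * (t - s) / (s - v) + CT * (t - s) / (w - t))" for x
  proof -
    \<comment> \<open>The intermediate term combines the shorter first transition
      \<open>s - v\<close> with \<open>\<psi> t\<close>. The denominators are then the smaller times
      of the two increments, s - v here and w - t below.\<close>
    have "\<bar>transition p (t - v) (\<psi> t) x - transition p (s - v) (\<psi> t) x\<bar> \<le> d * (CT * ((t - v) - (s - v)) / (s - v))"
      using time by (intro transition_increment[OF cond] density_prob \<psi>m \<psi>b) auto
    moreover have "\<bar>transition p (s - v) (\<psi> t) x - transition p (s - v) (\<psi> s) x\<bar> \<le> d * (CT * (t - s) / (w - t))"
    proof -
      have pd: "prob_density (p (s - v) x)" using time by (intro density_prob) auto
      have *: "\<bar>\<psi> t y - \<psi> s y\<bar> \<le> d * (CT * (t - s) / (w - t))" for y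
      proof -
        have "\<bar>transition p (w - s) g y - transition p (w - t) g y\<bar> \<le> d * (CT * ((w - s) - (w - t)) / (w - t))"
          using time by (intro transition_increment[OF cond] density_prob g) auto
        from abs_mult_le[OF h(2)[of y] this] show ?thesis
          unfolding \<psi>_def by (simp add: algebra_simps abs_minus_commute)
      qed
      have "transition p (s - v) (\<psi> t) x - transition p (s - v) (\<psi> s) x
          = (\<integral>y. p (s - v) x y * (\<psi> t y - \<psi> s y) \<partial>lborel)"
        using time prob_density_integrable_mult[OF pd \<psi>m \<psi>b, of t] prob_density_integrable_mult[OF pd \<psi>m \<psi>b, of s]
        by (simp add: transition_def right_diff_distrib)
      moreover have "\<bar>\<dots>\<bar> \<le> d * (CT * (t - s) / (w - t))"
        using time by (intro prob_density_integral_bound[OF pd] * borel_measurable_diff \<psi>m) auto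
      ultimately show ?thesis by simp
    qed
    ultimately have "\<bar>transition p (t - v) (\<psi> t) x - transition p (s - v) (\<psi> s) x\<bar>
        \<le> d * (CT * (t - s) / (s - v)) + d * (CT * (t - s) / (w - t))" by simp
    then show ?thesis by (simp add: distrib_left)
  qed
  have i: "integrable M (\<lambda>\<omega>. Y \<omega> * transition p (r - v) (\<psi> r) (X v \<omega>))" if r: "v < r" "r < w" for r
  proof (rule integrable_bounded[where c="c * d"])
    have [measurable]: "transition p (r - v) (\<psi> r) \<in> borel_measurable borel"
      using r by (intro transition_measurable \<psi>m) auto
    show "(\<lambda>\<omega>. Y \<omega> * transition p (r - v) (\<psi> r) (X v \<omega>)) \<in> borel_measurable M" by measurable
    show "\<bar>Y \<omega> * transition p (r - v) (\<psi> r) (X v \<omega>)\<bar> \<le> c * d" for \<omega>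
      using r by (intro abs_mult_le Y transition_bound \<psi>m \<psi>b) auto
  qed
  have "\<bar>(\<integral>\<omega>. Y \<omega> * h (X t \<omega>) * g (X w \<omega>) \<partial>M) - (\<integral>\<omega>. Y \<omega> * h (X s \<omega>) * g (X w \<omega>) \<partial>M)\<bar>
      = \<bar>(\<integral>\<omega>. Y \<omega> * transition p (t - v) (\<psi> t) (X v \<omega>) \<partial>M)
         - (\<integral>\<omega>. Y \<omega> * transition p (s - v) (\<psi> s) (X v \<omega>) \<partial>M)\<bar>"
    using two_step[of t] two_step[of s] time by simp
  also have "\<dots> \<le> c * (d * (CT * (t - s) / (s - v) + CT * (t - s) / (w - t)))"
  proof (rule integral_diff_bound)
    show "integrable M (\<lambda>\<omega>. Y \<omega> * transition p (t - v) (\<psi> t) (X v \<omega>))"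
      "integrable M (\<lambda>\<omega>. Y \<omega> * transition p (s - v) (\<psi> s) (X v \<omega>))" using i time by auto
    fix \<omega>
    show "\<bar>Y \<omega> * transition p (t - v) (\<psi> t) (X v \<omega>) - Y \<omega> * transition p (s - v) (\<psi> s) (X v \<omega>)\<bar>
        \<le> c * (d * (CT * (t - s) / (s - v) + CT * (t - s) / (w - t)))"
      unfolding right_diff_distrib[symmetric] by (rule abs_mult_le[OF Y(2) split])
  qed
  finally show ?thesis by (simp add: mult.assoc)
qed

end

section \<open>Occupation time\<close>

locale markov_occupation = markov_density M X p
  for M :: "'w measure" and X p +
  fixes h :: "real \<Rightarrow> real"
  assumes h_measurable[measurable]: "h \<in> borel_measurable borel"
    and h_nonneg: "\<And>x. 0 \<le> h x" and h_le_1: "\<And>x. h x \<le> 1"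
begin

lemma h_abs_le: "\<bar>h x\<bar> \<le> 1"
  using h_nonneg h_le_1 by (simp add: abs_of_nonneg)

text \<open>Extended by \<open>0\<close> off \<open>space M\<close>, where the trajectories need not be measurable.\<close>

definition occ :: "real \<Rightarrow> 'w \<Rightarrow> real" where
  "occ v \<omega> = (if \<omega> \<in> space M then LBINT t:{0..v}. h (X t \<omega>) else 0)"

lemma hX_joint_measurable:
  "(\<lambda>(t, \<omega>). h (X (max 0 t) \<omega>)) \<in> borel_measurable (lborel \<Otimes>\<^sub>M M)"
proof -
  have "(\<lambda>(t, \<omega>). X (max 0 t) \<omega>) \<in> borel_measurable (lborel \<Otimes>\<^sub>M M)"
    using X_measurable_joint by (simp cong: measurable_cong_sets sets_pair_measure_cong)
  from measurable_compose[OF this h_measurable] show ?thesis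
    by (simp add: case_prod_unfold)
qed

lemma hX_set_integrable:
  assumes "\<omega> \<in> space M" "0 \<le> a"
  shows "set_integrable lborel {a..b} (\<lambda>t. h (X t \<omega>))"
proof -
  have [measurable]: "(\<lambda>t. h (X (max 0 t) \<omega>)) \<in> borel_measurable lborel"
    using measurable_compose[OF measurable_Pair2'[OF assms(1), of lborel] hX_joint_measurable] by simp
  have "integrable lborel (\<lambda>t. indicator {a..b} t *\<^sub>R h (X (max 0 t) \<omega>))"
  proof (rule Bochner_Integration.integrable_bound[where f="\<lambda>t. indicator {a..b} t :: real"])
    show "AE t in lborel. norm (indicator {a..b} t *\<^sub>R h (X (max 0 t) \<omega>)) \<le> norm (indicator {a..b} t :: real)"
      using h_abs_le by (auto simp: indicator_def)
  qed (auto intro: integrable_indicator_Icc)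
  also have "(\<lambda>t. indicator {a..b} t *\<^sub>R h (X (max 0 t) \<omega>)) = (\<lambda>t. indicator {a..b} t *\<^sub>R h (X t \<omega>))"
    using assms by (auto simp: fun_eq_iff indicator_def max_def)
  finally show ?thesis by (simp add: set_integrable_def)
qed

lemma occ_add:
  assumes "\<omega> \<in> space M" "0 \<le> a" "a \<le> b"
  shows "occ b \<omega> = occ a \<omega> + (LBINT t:{a..b}. h (X t \<omega>))"
proof -
  have i: "set_integrable lborel {0..b} (\<lambda>t. h (X t \<omega>))" using hX_set_integrable assms by auto
  have "(LBINT t:{0..b}. h (X t \<omega>)) = (LBINT t:{0..a} \<union> {a<..b}. h (X t \<omega>))"
    using assms by (simp add: ivl_disj_un)
  also have "\<dots> = (LBINT t:{0..a}. h (X t \<omega>)) + (LBINT t:{a<..b}. h (X t \<omega>))"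
    by (rule set_integral_Un) (use assms in \<open>auto intro!: set_integrable_subset[OF i]\<close>)
  also have "(LBINT t:{a<..b}. h (X t \<omega>)) = (LBINT t:{a..b}. h (X t \<omega>))"
    unfolding set_lebesgue_integral_def
  proof (rule integral_cong_AE)
    have "{a..b} \<subseteq> {0..b}" "{a<..b} \<subseteq> {0..b}" using assms by auto
    then have "set_borel_measurable lborel {a..b} (\<lambda>t. h (X t \<omega>))"
      "set_borel_measurable lborel {a<..b} (\<lambda>t. h (X t \<omega>))"
      using set_integrable_subset[OF i, of "{a..b}"] set_integrable_subset[OF i, of "{a<..b}"]
      by (auto simp: set_integrable_def set_borel_measurable_def)
    then show "(\<lambda>t. indicator {a..b} t *\<^sub>R h (X t \<omega>)) \<in> borel_measurable lborel"
      "(\<lambda>t. indicator {a<..b} t *\<^sub>R h (X t \<omega>)) \<in> borel_measurable lborel"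
      by (auto simp: set_borel_measurable_def)
    show "AE t in lborel. indicator {a<..b} t *\<^sub>R h (X t \<omega>) = indicator {a..b} t *\<^sub>R h (X t \<omega>)"
      using AE_lborel_singleton[of a] by eventually_elim (auto simp: indicator_def)
  qed
  finally show ?thesis using assms by (simp add: occ_def)
qed

lemma set_integral_hX_bounds:
  assumes "\<omega> \<in> space M" "0 \<le> a" "a \<le> b"
  shows "0 \<le> (LBINT t:{a..b}. h (X t \<omega>))" "(LBINT t:{a..b}. h (X t \<omega>)) \<le> b - a"
proof -
  show "0 \<le> (LBINT t:{a..b}. h (X t \<omega>))"
    unfolding set_lebesgue_integral_def using h_nonneg by (intro Bochner_Integration.integral_nonneg) auto
  have "(LBINT t:{a..b}. h (X t \<omega>)) \<le> (LBINT t:{a..b}. 1)"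
    using assms h_le_1 by (intro set_integral_mono hX_set_integrable) (auto simp: set_integrable_def)
  also have "\<dots> = b - a" using assms by (simp add: set_lebesgue_integral_def)
  finally show "(LBINT t:{a..b}. h (X t \<omega>)) \<le> b - a" .
qed

text \<open>Off \<open>space M\<close> both values are 0, so the bounds hold for every \<omega> and
  can be chained pointwise without membership conditions.\<close>

lemma occ_increment:
  assumes "0 \<le> a" "a \<le> b"
  shows "0 \<le> occ b \<omega> - occ a \<omega>" "occ b \<omega> - occ a \<omega> \<le> b - a"
  using occ_add[of \<omega> a b] set_integral_hX_bounds[of \<omega> a b] assms
  by (cases "\<omega> \<in> space M"; simp add: occ_def)+

lemma occ_0: "occ 0 \<omega> = 0"
proof -
  have "(LBINT t:{0}. h (X t \<omega>)) = 0"
    unfolding set_lebesgue_integral_def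
    by (rule integral_eq_zero_AE) (use AE_lborel_singleton[of 0] in eventually_elim, auto)
  then show ?thesis by (simp add: occ_def)
qed

text \<open>Since h takes values in [0, 1], the product is dominated by \<open>W\<close> times the
  indicator of [a, b], which is integrable on the product space; Fubini gives the first two claims,
  and measurability of parametrised integrals the third.\<close>

lemma fubini_hX:
  assumes W: "integrable M W" and ab: "0 \<le> a" "a \<le> b"
  shows "(\<integral>\<omega>. W \<omega> * (LBINT t:{a..b}. h (X t \<omega>)) \<partial>M) = (LBINT t:{a..b}. (\<integral>\<omega>. W \<omega> * h (X t \<omega>) \<partial>M))"
    and "set_integrable lborel {a..b} (\<lambda>t. \<integral>\<omega>. W \<omega> * h (X t \<omega>) \<partial>M)"
    and "(\<lambda>\<omega>. LBINT t:{a..b}. h (X t \<omega>)) \<in> borel_measurable M"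
proof -
  interpret P: pair_sigma_finite lborel M ..
  note hX_joint_measurable[measurable]
  have [measurable]: "W \<in> borel_measurable M" using W by auto
  define k where "k t \<omega> = indicator {a..b} t * h (X (max 0 t) \<omega>)" for t \<omega>
  have km[measurable]: "case_prod k \<in> borel_measurable (lborel \<Otimes>\<^sub>M M)"
    unfolding k_def by (simp add: case_prod_unfold split_beta')
  have k: "k t \<omega> = indicator {a..b} t *\<^sub>R h (X t \<omega>)" for t \<omega>
    using ab by (auto simp: k_def indicator_def max_def)
  have i: "integrable (lborel \<Otimes>\<^sub>M M) (\<lambda>(t, \<omega>). W \<omega> * k t \<omega>)"
  proof (rule Bochner_Integration.integrable_bound)
    show "integrable (lborel \<Otimes>\<^sub>M M) (\<lambda>(t, \<omega>). indicator {a..b} t * W \<omega>)"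
      using W integrable_indicator_Icc[of a b] by (intro P.Fubini_integrable) (auto simp: abs_mult)
    show "AE z in lborel \<Otimes>\<^sub>M M. norm (case z of (t, \<omega>) \<Rightarrow> W \<omega> * k t \<omega>)
        \<le> norm (case z of (t, \<omega>) \<Rightarrow> indicator {a..b} t * W \<omega>)"
      using h_abs_le by (intro AE_I2) (auto simp: k_def abs_mult indicator_def split: prod.split intro!: mult_left_le)
  qed simp
  have "(\<integral>\<omega>. (\<integral>t. W \<omega> * k t \<omega> \<partial>lborel) \<partial>M) = (\<integral>t. (\<integral>\<omega>. W \<omega> * k t \<omega> \<partial>M) \<partial>lborel)"
    by (rule P.Fubini_integral[OF i])
  moreover have kk: "(\<integral>\<omega>. W \<omega> * k t \<omega> \<partial>M) = indicator {a..b} t *\<^sub>R (\<integral>\<omega>. W \<omega> * h (X t \<omega>) \<partial>M)" for t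
    by (simp add: k indicator_def)
  ultimately show "(\<integral>\<omega>. W \<omega> * (LBINT t:{a..b}. h (X t \<omega>)) \<partial>M) = (LBINT t:{a..b}. (\<integral>\<omega>. W \<omega> * h (X t \<omega>) \<partial>M))"
    unfolding set_lebesgue_integral_def k[symmetric] by simp
  show "set_integrable lborel {a..b} (\<lambda>t. \<integral>\<omega>. W \<omega> * h (X t \<omega>) \<partial>M)"
    using P.integrable_fst[OF i] unfolding set_integrable_def kk .
  have "(\<lambda>(\<omega>, t). k t \<omega>) \<in> borel_measurable (M \<Otimes>\<^sub>M lborel)"
    using measurable_compose[OF measurable_pair_swap' km] by (simp add: case_prod_unfold)
  then have "(\<lambda>\<omega>. \<integral>t. k t \<omega> \<partial>lborel) \<in> borel_measurable M"
    by (rule lborel.borel_measurable_lebesgue_integral)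
  then show "(\<lambda>\<omega>. LBINT t:{a..b}. h (X t \<omega>)) \<in> borel_measurable M"
    unfolding set_lebesgue_integral_def k .
qed

lemma occ_measurable:
  assumes "0 \<le> v" shows "occ v \<in> borel_measurable M"
proof -
  have "(\<lambda>\<omega>. LBINT t:{0..v}. h (X t \<omega>)) \<in> borel_measurable M"
    by (rule fubini_hX(3)[of "\<lambda>_. 0"]) (use assms in auto)
  then show ?thesis by (rule measurable_cong[THEN iffD2, rotated]) (simp add: occ_def)
qed

lemma occ_abs_le: "0 \<le> v \<Longrightarrow> \<bar>occ v \<omega>\<bar> \<le> v"
  using occ_increment[of 0 v \<omega>] by (simp add: occ_0)

text \<open>Without progressive measurability of \<open>X\<close>, \<open>occ v\<close> need not be measurable for the natural
  filtration; but testing against an arbitrary event shows that it coincides almost surely with its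
  conditional expectation.\<close>

lemma occ_adapted_ae:
  assumes v: "0 \<le> v" shows "adapted_ae v (occ v)"
proof -
  interpret sigma_finite_subalgebra M "F v" by (rule F_sigma_finite)
  note occ_measurable[OF v, measurable]
  let ?E = "real_cond_exp M (F v)"
  have io: "integrable M (occ v)"
    by (rule integrable_bounded[OF _ occ_abs_le]) (use v in auto)
  have occ_int: "(\<integral>\<omega>. W \<omega> * occ v \<omega> \<partial>M) = (LBINT t:{0..v}. (\<integral>\<omega>. W \<omega> * h (X t \<omega>) \<partial>M))"
    if "integrable M W" for W
  proof -
    have "(\<integral>\<omega>. W \<omega> * occ v \<omega> \<partial>M) = (\<integral>\<omega>. W \<omega> * (LBINT t:{0..v}. h (X t \<omega>)) \<partial>M)"
      by (intro Bochner_Integration.integral_cong) (simp_all add: occ_def)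
    then show ?thesis using fubini_hX(1)[OF that, of 0 v] v by simp
  qed
  have "AE \<omega> in M. occ v \<omega> = ?E (occ v) \<omega>"
  proof (rule density_unique_real)
    show "integrable M (?E (occ v))" using io by (rule real_cond_exp_int(1))
    fix A assume A[measurable]: "A \<in> sets M"
    have iA: "integrable M (indicator A :: _ \<Rightarrow> real)"
      by (rule integrable_bounded[where c=1]) (auto simp: indicator_def)
    have iEA: "integrable M (?E (indicator A))" using iA by (rule real_cond_exp_int(1))
    have bm: "integrable M (\<lambda>\<omega>. W \<omega> * occ v \<omega>)" if W: "integrable M W" for W
    proof (rule Bochner_Integration.integrable_bound)
      show "integrable M (\<lambda>\<omega>. v * W \<omega>)" using W by simp
      show "(\<lambda>\<omega>. W \<omega> * occ v \<omega>) \<in> borel_measurable M" using W by measurable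
      show "AE \<omega> in M. norm (W \<omega> * occ v \<omega>) \<le> norm (v * W \<omega>)"
        using mult_left_mono[OF occ_abs_le[OF v], of "\<bar>W \<omega>\<bar>" \<omega> for \<omega>] v
        by (intro AE_I2) (simp add: abs_mult mult.commute)
    qed
    have "(\<integral>\<omega>. indicator A \<omega> * occ v \<omega> \<partial>M) = (LBINT t:{0..v}. (\<integral>\<omega>. indicator A \<omega> * h (X t \<omega>) \<partial>M))"
      by (rule occ_int[OF iA])
    \<comment> \<open>For fixed t in [0, v] the variable h(X_t) is \<open>F v\<close>-measurable, so
      under the time integral the indicator of A may be replaced by its conditional
      expectation.\<close>
    also have "\<dots> = (LBINT t:{0..v}. (\<integral>\<omega>. ?E (indicator A) \<omega> * h (X t \<omega>) \<partial>M))"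
    proof (rule set_lebesgue_integral_cong)
      show "\<forall>t. t \<in> {0..v} \<longrightarrow> (\<integral>\<omega>. indicator A \<omega> * h (X t \<omega>) \<partial>M) = (\<integral>\<omega>. ?E (indicator A) \<omega> * h (X t \<omega>) \<partial>M)"
      proof (intro allI impI)
        fix t assume t: "t \<in> {0..v}"
        have [measurable]: "X t \<in> borel_measurable M" using X_measurable t by simp
        have "(\<integral>\<omega>. h (X t \<omega>) * ?E (indicator A) \<omega> \<partial>M) = (\<integral>\<omega>. h (X t \<omega>) * indicator A \<omega> \<partial>M)"
        proof (rule real_cond_exp_intg(2))
          show "integrable M (\<lambda>\<omega>. h (X t \<omega>) * indicator A \<omega>)"
            using h_abs_le by (intro integrable_bounded[where c=1]) (auto simp: indicator_def)
          show "(\<lambda>\<omega>. h (X t \<omega>)) \<in> borel_measurable (F v)"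
            using t by (intro measurable_compose[OF X_F_measurable h_measurable]) auto
        qed simp
        then show "(\<integral>\<omega>. indicator A \<omega> * h (X t \<omega>) \<partial>M) = (\<integral>\<omega>. ?E (indicator A) \<omega> * h (X t \<omega>) \<partial>M)"
          by (simp add: mult.commute)
      qed
    qed simp
    also have "\<dots> = (\<integral>\<omega>. ?E (indicator A) \<omega> * occ v \<omega> \<partial>M)"
      by (rule occ_int[OF iEA, symmetric])
    also have "\<dots> = (\<integral>\<omega>. ?E (indicator A) \<omega> * ?E (occ v) \<omega> \<partial>M)"
      by (rule real_cond_exp_intg(2)[symmetric]) (use bm[OF iEA] in auto)
    also have "\<dots> = (\<integral>\<omega>. ?E (occ v) \<omega> * ?E (indicator A) \<omega> \<partial>M)"
      by (simp add: mult.commute)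
    also have "\<dots> = (\<integral>\<omega>. ?E (occ v) \<omega> * indicator A \<omega> \<partial>M)"
    proof (rule real_cond_exp_intg(2))
      show "integrable M (\<lambda>\<omega>. ?E (occ v) \<omega> * indicator A \<omega>)"
        using integrable_mult_indicator[OF A real_cond_exp_int(1)[OF io]] by (simp add: mult.commute)
    qed auto
    finally show "(LINT \<omega>:A|M. occ v \<omega>) = (LINT \<omega>:A|M. ?E (occ v) \<omega>)"
      by (simp add: set_lebesgue_integral_def mult.commute)
  qed (rule io)
  then show ?thesis
    unfolding adapted_ae_def by (intro conjI bexI[of _ "?E (occ v)"]) auto
qed

end

section \<open>Elementary estimates\<close>

lemma exp_minus_second_order:
  fixes x :: real
  assumes "0 \<le> x"
  shows "0 \<le> exp (- x) - 1 + x" "exp (- x) - 1 + x \<le> x\<^sup>2 / 2"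
proof -
  show "0 \<le> exp (- x) - 1 + x" using exp_ge_add_one_self[of "-x"] by linarith
  define g :: "real \<Rightarrow> real" where "g y = y\<^sup>2 / 2 - (exp (- y) - 1 + y)" for y
  have "g 0 \<le> g x"
  proof (rule DERIV_nonneg_imp_nondecreasing[OF assms])
    fix y :: real
    have "(g has_real_derivative y + exp (- y) - 1) (at y)"
      unfolding g_def by (auto intro!: derivative_eq_intros)
    moreover have "0 \<le> y + exp (- y) - 1" using exp_ge_add_one_self[of "-y"] by linarith
    ultimately show "\<exists>d. (g has_real_derivative d) (at y) \<and> 0 \<le> d" by blast
  qed
  then show "exp (- x) - 1 + x \<le> x\<^sup>2 / 2" by (simp add: g_def)
qed

text \<open>The two second-order remainders both lie in [0, e^2/2], so their difference has the
  bound of one remainder, not of two.\<close>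

lemma exp_minus_diff_linear:
  fixes x y e :: real
  assumes "0 \<le> x" "x \<le> e" "0 \<le> y" "y \<le> e"
  shows "\<bar>exp (- x) - exp (- y) - (y - x)\<bar> \<le> e\<^sup>2 / 2"
proof -
  have "x\<^sup>2 \<le> e\<^sup>2" "y\<^sup>2 \<le> e\<^sup>2" using assms by (auto intro!: power_mono)
  then show ?thesis
    using exp_minus_second_order[OF assms(1)] exp_minus_second_order[OF assms(3)] by linarith
qed

lemma abs_exp_minus_diff_le:
  fixes x y :: real
  assumes "0 \<le> x" "x \<le> y"
  shows "\<bar>exp (- y) - exp (- x)\<bar> \<le> y - x"
proof -
  have "exp (- x) - exp (- y) = exp (- x) * (1 - exp (- (y - x)))"
    by (simp add: right_diff_distrib flip: exp_add)
  also have "\<dots> \<le> 1 * (1 - exp (- (y - x)))"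
    using assms by (intro mult_right_mono) auto
  also have "\<dots> = 1 - exp (x - y)" by simp
  also have "\<dots> \<le> y - x" using exp_ge_add_one_self[of "x - y"] by linarith
  finally show ?thesis using assms by simp
qed

text \<open>The value \<open>1\<close> at \<open>m = 0\<close> covers the cells adjacent to a layer, where the density estimate is void
  and only the trivial bound is available.\<close>

definition rec_weight :: "nat \<Rightarrow> real" where
  "rec_weight m = (if m = 0 then 1 else 1 / real m)"

lemma rec_weight_nonneg: "0 \<le> rec_weight m"
  by (simp add: rec_weight_def)

text \<open>With b = \<rho> \<delta> this bounds the i-th telescoping increment of the past or of
  the future: the zeroth is the constant 1, the others are differences over one cell.\<close>

definition layer_weight :: "real \<Rightarrow> nat \<Rightarrow> real" where
  "layer_weight b i = (if i = 0 then 1 else b)"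

lemma layer_weight_nonneg: "0 \<le> b \<Longrightarrow> 0 \<le> layer_weight b i"
  by (simp add: layer_weight_def)

lemma sum_layer_weight: "(\<Sum>i\<le>k. layer_weight b i) = 1 + b * real k"
  by (induction k) (simp_all add: layer_weight_def algebra_simps)

lemma sum_layer_weight_le:
  assumes "0 \<le> b" "k < n" shows "(\<Sum>i\<le>k. layer_weight b i) \<le> 1 + b * real n"
  unfolding sum_layer_weight using assms by (simp add: mult_left_mono)

text \<open>Indexed by i and the distance j = k - i, the sum runs over the triangle i + j < n. All
  terms are nonnegative, so the triangle may be enlarged to a square, on which the sum
  factorizes.\<close>

lemma sum_convolution_le:
  fixes b :: real
  assumes b: "0 \<le> b"
  shows "(\<Sum>k<n. \<Sum>i\<le>k. layer_weight b i * rec_weight (k - i)) \<le> (1 + b * real n) * (\<Sum>m<n. rec_weight m)"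
proof (cases "n = 0")
  case False
  then obtain k where k: "n = Suc k" using not0_implies_Suc by blast
  have "(\<Sum>k<n. \<Sum>i\<le>k. layer_weight b i * rec_weight (k - i))
      = (\<Sum>(i, j)\<in>{(i, j). i + j < n}. layer_weight b i * rec_weight j)"
    by (rule sum.triangle_reindex[symmetric])
  also have "\<dots> \<le> (\<Sum>(i, j)\<in>{..<n} \<times> {..<n}. layer_weight b i * rec_weight j)"
    using b by (intro sum_mono2) (auto intro!: mult_nonneg_nonneg layer_weight_nonneg rec_weight_nonneg)
  also have "\<dots> = (\<Sum>i<n. layer_weight b i) * (\<Sum>m<n. rec_weight m)"
    by (simp add: sum_product sum.cartesian_product)
  also have "\<dots> \<le> (1 + b * real n) * (\<Sum>m<n. rec_weight m)"
  proof (rule mult_right_mono)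
    show "(\<Sum>i<n. layer_weight b i) \<le> 1 + b * real n"
      using sum_layer_weight_le[OF b, of k n] by (simp add: k lessThan_Suc_atMost)
  qed (simp add: sum_nonneg rec_weight_nonneg)
  finally show ?thesis .
qed simp

text \<open>The distance weight is a sum of a past and a future term. In each part the layers of the
  other side decouple and contribute at most 1 + b n, which leaves a one-sided convolution; the
  reflection of k to n - Suc k carries one part into the other, hence the factor 2.\<close>

lemma sum_two_sided_le:
  fixes b :: real
  assumes b: "0 \<le> b"
  shows "(\<Sum>k<n. \<Sum>i\<le>k. \<Sum>l\<le>n - Suc k. layer_weight b i * layer_weight b l * (rec_weight (k - i) + rec_weight (n - Suc k - l)))
    \<le> 2 * (1 + b * real n)\<^sup>2 * (\<Sum>m<n. rec_weight m)"
proof -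
  define s where "s k = (\<Sum>i\<le>k. layer_weight b i)" for k
  define B where "B k = (\<Sum>i\<le>k. layer_weight b i * rec_weight (k - i))" for k
  have B0: "0 \<le> B k" for k
    unfolding B_def using b by (intro sum_nonneg mult_nonneg_nonneg layer_weight_nonneg rec_weight_nonneg)
  have sum_B: "(\<Sum>k<n. B k) \<le> (1 + b * real n) * (\<Sum>m<n. rec_weight m)"
    unfolding B_def by (rule sum_convolution_le[OF b])
  have "(\<Sum>k<n. \<Sum>i\<le>k. \<Sum>l\<le>n - Suc k. layer_weight b i * layer_weight b l * (rec_weight (k - i) + rec_weight (n - Suc k - l)))
      = (\<Sum>k<n. \<Sum>i\<le>k. \<Sum>l\<le>n - Suc k. layer_weight b i * rec_weight (k - i) * layer_weight b l
          + layer_weight b i * (layer_weight b l * rec_weight (n - Suc k - l)))"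
    by (intro sum.cong refl) (simp add: algebra_simps)
  also have "\<dots> = (\<Sum>k<n. B k * s (n - Suc k) + s k * B (n - Suc k))"
    by (simp add: B_def s_def sum_product sum.distrib)
  also have "\<dots> \<le> (\<Sum>k<n. B k * (1 + b * real n) + (1 + b * real n) * B (n - Suc k))"
    using b by (intro sum_mono add_mono mult_left_mono mult_right_mono B0)
      (auto simp: s_def intro!: sum_layer_weight_le)
  also have "\<dots> = (1 + b * real n) * ((\<Sum>k<n. B k) + (\<Sum>k<n. B (n - Suc k)))"
    by (simp add: sum.distrib sum_distrib_left distrib_left mult.commute)
  also have "(\<Sum>k<n. B (n - Suc k)) = (\<Sum>k<n. B k)"
    by (rule sum.nat_diff_reindex)
  also have "(1 + b * real n) * ((\<Sum>k<n. B k) + (\<Sum>k<n. B k))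
      \<le> (1 + b * real n) * (2 * ((1 + b * real n) * (\<Sum>m<n. rec_weight m)))"
    using sum_B b by (intro mult_left_mono) auto
  finally show ?thesis by (simp add: power2_eq_square mult_ac)
qed

text \<open>The summand 1/8 reserves room for the quadratic remainder in
  \<open>discretization_constant\<close>. The induction step compares 2/n with 6/(n + 1), and 1/(n +
  1) with ln(n + 1) - ln n.\<close>

lemma sum_rec_weight_ln:
  assumes "n \<ge> 2"
  shows "2 * (\<Sum>m<n. rec_weight m) + 1/8 \<le> 6 * ln (real n)"
  using assms
proof (induction n rule: nat_induct_at_least)
  case base
  \<comment> \<open>For n = 2 the weights sum to 2, so the claim is 33/8 <= 6 ln 2, that is 11/16 <=
    ln 2. It follows from e < 2.72 and 2.72^11 <= 2^16.\<close>
  have "(11::real) < 11 * ln (272 / 100)" using ln_272_gt_1 by simp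
  also have "\<dots> = ln ((272 / 100) ^ 11)" by (subst ln_realpow) auto
  also have "\<dots> \<le> ln (2 ^ 16)" by (subst ln_le_cancel_iff) (auto simp: power_divide)
  also have "\<dots> = 16 * ln (2::real)" by (subst ln_realpow) auto
  finally show ?case by (simp add: rec_weight_def numeral_2_eq_2)
next
  case (Suc n)
  have n: "real n > 0" using Suc by simp
  have "ln (real n / real (Suc n)) \<le> real n / real (Suc n) - 1"
    using n by (intro ln_le_minus_one) auto
  then have "1 / (real n + 1) \<le> ln (real (Suc n)) - ln (real n)"
    using n by (simp add: ln_div field_simps)
  moreover have "2 / real n \<le> 6 * (1 / (real n + 1))"
    using Suc by (simp add: field_simps)
  ultimately show ?case using Suc n by (simp add: rec_weight_def)
qed

text \<open>A nonzero excess forces s > N because the payoff is at most s. There s = s^u s^(1 - u),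
  and the negative exponent 1 - u allows s to be replaced by N in the second factor.\<close>

lemma call_tail_bound:
  fixes s K N u :: real
  assumes "0 < s" "0 \<le> K" "0 < N" "1 < u"
  shows "max (s - K) 0 - min (max (s - K) 0) N \<le> s powr u * N powr (1 - u)"
proof (cases "N < s")
  case True
  have "max (s - K) 0 - min (max (s - K) 0) N \<le> s" using assms by (auto simp: max_def min_def)
  also have "s = s powr u * s powr (1 - u)" using assms by (simp flip: powr_add)
  also have "\<dots> \<le> s powr u * N powr (1 - u)"
    using assms True by (intro mult_left_mono powr_mono2') auto
  finally show ?thesis .
next
  case False
  then have "max (s - K) 0 - min (max (s - K) 0) N = 0" using assms by (auto simp: max_def min_def)
  then show ?thesis by simp
qed

text \<open>Here a will be \<rho> T. From 4 a <= (1 + a)^2 the quadratic term is at most one eighth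
  of C a (1 + a)^2, which explains the 1/8 in \<open>sum_rec_weight_ln\<close>; then one factor 1 +
  a is replaced by exp a.\<close>

lemma discretization_constant:
  fixes C a :: real
  assumes n: "n \<ge> 2" and C: "1 \<le> C" and a: "0 \<le> a"
  shows "2 * C * a * (1 + a)\<^sup>2 * (\<Sum>m<n. rec_weight m) + a\<^sup>2 / 2 \<le> 6 * C * a * (1 + a) * exp a * ln (real n)"
proof -
  let ?A = "C * a * (1 + a)\<^sup>2"
  have "a\<^sup>2 / 2 = a * (4 * a) / 8" by (simp add: power2_eq_square)
  also have "\<dots> \<le> a * (1 + a)\<^sup>2 / 8"
  proof -
    have "4 * a \<le> (1 + a)\<^sup>2" using zero_le_power2[of "1 - a"] by (simp add: power2_eq_square algebra_simps)
    then show ?thesis using a by (intro divide_right_mono mult_left_mono) auto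
  qed
  also have "\<dots> \<le> ?A / 8"
    using mult_right_mono[OF C, of "a * (1 + a)\<^sup>2"] a by simp
  finally have "2 * C * a * (1 + a)\<^sup>2 * (\<Sum>m<n. rec_weight m) + a\<^sup>2 / 2
      \<le> ?A * (2 * (\<Sum>m<n. rec_weight m) + 1/8)"
    by (simp add: algebra_simps)
  also have "\<dots> \<le> ?A * (6 * ln (real n))"
    using sum_rec_weight_ln[OF n] a C by (intro mult_left_mono) auto
  also have "\<dots> = 6 * C * a * (1 + a) * ln (real n) * (1 + a)"
    by (simp add: power2_eq_square)
  also have "\<dots> \<le> 6 * C * a * (1 + a) * ln (real n) * exp a"
    using a C n by (intro mult_left_mono exp_ge_add_one_self) auto
  finally show ?thesis by (simp add: mult_ac)
qed

section \<open>Discretization error for bounded payoffs\<close>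

text \<open>\<open>f\<close> stands for the truncated payoff as a function of the terminal position,
  and \<open>N\<close> for its truncation level.\<close>

locale discretized_occupation = markov_occupation M X p h
  for M :: "'w measure" and X p h +
  fixes q :: "real \<Rightarrow> real \<Rightarrow> real \<Rightarrow> real" and T CT \<rho> \<delta> N :: real and n :: nat and f :: "real \<Rightarrow> real"
  assumes cond: "condition_X p q T CT"
    and rho: "0 \<le> \<rho>" and delta: "0 < \<delta>" and mesh: "real n * \<delta> = T" and n_pos: "0 < n"
    and f_measurable[measurable]: "f \<in> borel_measurable borel" and f_bound: "\<And>x. \<bar>f x\<bar> \<le> N"
begin

lemma N_nonneg: "0 \<le> N"
  using f_bound[of undefined] by linarith

lemma CT_ge_1: "1 \<le> CT"
  using cond by (simp add: condition_X_def)

abbreviation \<tau> :: "nat \<Rightarrow> real" where "\<tau> k \<equiv> real k * \<delta>"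

definition \<phi> :: "real \<Rightarrow> real" where "\<phi> x = exp (- (\<rho> * \<delta> * h x))"

definition past :: "nat \<Rightarrow> 'w \<Rightarrow> real" where
  "past k \<omega> = exp (- (\<rho> * occ (\<tau> k) \<omega>))"

text \<open>Layers of the future are counted backwards from the maturity, so that past and future play
  symmetric roles.\<close>

definition future :: "nat \<Rightarrow> 'w \<Rightarrow> real" where
  "future l \<omega> = (\<Prod>i<l. \<phi> (X (\<tau> (n - Suc i)) \<omega>))"

text \<open>Telescoping increments: all layers but the zeroth are of size \<open>\<rho> \<delta>\<close>, and \<open>past_layer i\<close> is known
  at time \<open>i \<delta>\<close>, hence usually long before the cell under consideration.\<close>

definition past_layer :: "nat \<Rightarrow> 'w \<Rightarrow> real" where
  "past_layer i \<omega> = (if i = 0 then 1 else past i \<omega> - past (i - 1) \<omega>)"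

definition future_layer :: "nat \<Rightarrow> 'w \<Rightarrow> real" where
  "future_layer l \<omega> = (if l = 0 then 1 else future l \<omega> - future (l - 1) \<omega>)"

text \<open>A discrete Feynman-Kac recursion: \<open>backward_value l\<close> gives the conditional
  expectation of \<open>future l\<close> times the payoff, given the position l steps before
  maturity.\<close>

primrec backward_value :: "nat \<Rightarrow> real \<Rightarrow> real" where
  "backward_value 0 = f"
| "backward_value (Suc l) = (\<lambda>x. \<phi> x * transition p \<delta> (backward_value l) x)"

text \<open>The analogue of \<open>backward_value\<close> for a single
  \<open>future_layer l\<close>. The earliest discount factor is replaced by its difference to 1,
  which carries the smallness \<rho> \<delta>.\<close>

definition layer_value :: "nat \<Rightarrow> real \<Rightarrow> real" where
  "layer_value l = (case l of 0 \<Rightarrow> f | Suc m \<Rightarrow> (\<lambda>x. (\<phi> x - 1) * transition p \<delta> (backward_value m) x))"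

lemma phi_measurable[measurable]: "\<phi> \<in> borel_measurable borel"
  unfolding \<phi>_def[abs_def] by measurable

lemma phi_bounds: "0 < \<phi> x" "\<phi> x \<le> 1" "\<bar>\<phi> x\<bar> \<le> 1" "\<bar>\<phi> x - 1\<bar> \<le> \<rho> * \<delta>"
proof -
  have "0 \<le> \<rho> * \<delta> * h x" using rho delta h_nonneg by simp
  moreover have "\<rho> * \<delta> * h x \<le> \<rho> * \<delta>" using rho delta h_le_1 by (simp add: mult_left_le)
  ultimately show "0 < \<phi> x" "\<phi> x \<le> 1" "\<bar>\<phi> x\<bar> \<le> 1" "\<bar>\<phi> x - 1\<bar> \<le> \<rho> * \<delta>"
    using abs_exp_minus_diff_le[of 0 "\<rho> * \<delta> * h x"] by (auto simp: \<phi>_def)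
qed

lemma backward_value_measurable_bound:
  "backward_value l \<in> borel_measurable borel \<and> (\<forall>x. \<bar>backward_value l x\<bar> \<le> N)"
proof (induction l)
  case (Suc l)
  then have [measurable]: "transition p \<delta> (backward_value l) \<in> borel_measurable borel"
    using delta by (intro transition_measurable) auto
  have "\<bar>\<phi> x * transition p \<delta> (backward_value l) x\<bar> \<le> 1 * N" for x
    using Suc delta by (intro abs_mult_le phi_bounds transition_bound) auto
  then show ?case by simp
qed (simp add: f_bound f_measurable)

lemmas backward_value_measurable = backward_value_measurable_bound[THEN conjunct1]
  and backward_value_bound = backward_value_measurable_bound[THEN conjunct2, rule_format]

lemma layer_value_measurable: "layer_value l \<in> borel_measurable borel"
proof (cases l)
  case (Suc m)
  have [measurable]: "transition p \<delta> (backward_value m) \<in> borel_measurable borel"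
    using delta backward_value_measurable by (intro transition_measurable) auto
  show ?thesis by (simp add: layer_value_def Suc)
qed (simp add: layer_value_def f_measurable)

lemma layer_value_bound: "\<bar>layer_value l x\<bar> \<le> layer_weight (\<rho> * \<delta>) l * N"
proof (cases l)
  case (Suc m)
  have "\<bar>(\<phi> x - 1) * transition p \<delta> (backward_value m) x\<bar> \<le> (\<rho> * \<delta>) * N"
    using delta by (intro abs_mult_le phi_bounds transition_bound backward_value_measurable backward_value_bound)
  then show ?thesis by (simp add: layer_value_def layer_weight_def Suc)
qed (simp add: layer_value_def layer_weight_def f_bound)

lemma tau_nonneg: "0 \<le> \<tau> k"
  using delta by simp

lemma X_tau_measurable[measurable]: "X (\<tau> k) \<in> borel_measurable M"
  using tau_nonneg by (rule X_measurable)

lemma X_T_measurable[measurable]: "X T \<in> borel_measurable M"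
  using X_tau_measurable[of n] by (simp add: mesh)

lemma future_measurable[measurable]: "future l \<in> borel_measurable M"
  unfolding future_def[abs_def] by measurable

lemma future_Suc: "future (Suc l) \<omega> = \<phi> (X (\<tau> (n - Suc l)) \<omega>) * future l \<omega>"
  by (simp add: future_def mult.commute)

lemma future_abs_le: "\<bar>future l \<omega>\<bar> \<le> 1"
proof (induction l)
  case (Suc l)
  show ?case using abs_mult_le[OF phi_bounds(3) Suc] by (simp add: future_Suc)
qed (simp add: future_def)

lemma past_measurable[measurable]: "past k \<in> borel_measurable M"
  using occ_measurable[OF tau_nonneg] unfolding past_def[abs_def] by measurable

lemma past_adapted: "adapted_ae (\<tau> k) (past k)"
  unfolding past_def[abs_def] by (rule adapted_ae_compose[OF occ_adapted_ae[OF tau_nonneg]]) measurable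

lemma past_bounds: "0 \<le> past k \<omega>" "past k \<omega> \<le> 1"
proof -
  have "0 \<le> occ (\<tau> k) \<omega>"
    using occ_increment(1)[of 0 "\<tau> k" \<omega>] tau_nonneg by (simp add: occ_0)
  then show "0 \<le> past k \<omega>" "past k \<omega> \<le> 1" using rho by (auto simp: past_def)
qed

lemma past_layer_measurable[measurable]: "past_layer i \<in> borel_measurable M"
  unfolding past_layer_def[abs_def] by measurable

lemma past_layer_adapted: "adapted_ae (\<tau> i) (past_layer i)"
proof (cases i)
  case (Suc m)
  have "adapted_ae (\<tau> (Suc m)) (past m)"
    by (rule adapted_ae_mono[OF past_adapted]) (use delta in simp)
  then show ?thesis
    unfolding Suc past_layer_def using adapted_ae_diff[OF past_adapted[of "Suc m"]] by simp
next
  case 0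
  have "past_layer 0 = (\<lambda>_. 1)" by (simp add: fun_eq_iff past_layer_def)
  then show ?thesis by (simp add: 0 adapted_ae_const)
qed

lemma past_layer_bound: "\<bar>past_layer i \<omega>\<bar> \<le> layer_weight (\<rho> * \<delta>) i"
proof (cases i)
  case (Suc m)
  have *: "0 \<le> occ (\<tau> i) \<omega> - occ (\<tau> m) \<omega>" "occ (\<tau> i) \<omega> - occ (\<tau> m) \<omega> \<le> \<delta>" "0 \<le> occ (\<tau> m) \<omega>"
    using occ_increment[of "\<tau> m" "\<tau> i" \<omega>] occ_increment(1)[of 0 "\<tau> m" \<omega>] delta
    by (auto simp: occ_0 Suc algebra_simps)
  have "\<bar>past i \<omega> - past m \<omega>\<bar> \<le> \<rho> * occ (\<tau> i) \<omega> - \<rho> * occ (\<tau> m) \<omega>"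
    unfolding past_def using * rho by (intro abs_exp_minus_diff_le mult_left_mono mult_nonneg_nonneg) auto
  also have "\<dots> \<le> \<rho> * \<delta>"
    using mult_left_mono[OF *(2) rho] by (simp add: right_diff_distrib)
  finally show ?thesis by (simp add: past_layer_def layer_weight_def Suc)
qed (simp add: past_layer_def layer_weight_def)

lemma future_layer_measurable[measurable]: "future_layer l \<in> borel_measurable M"
  unfolding future_layer_def[abs_def] by measurable

lemma future_layer_Suc: "future_layer (Suc l) \<omega> = (\<phi> (X (\<tau> (n - Suc l)) \<omega>) - 1) * future l \<omega>"
  by (simp add: future_layer_def future_Suc left_diff_distrib)

lemma future_layer_bound: "\<bar>future_layer l \<omega>\<bar> \<le> layer_weight (\<rho> * \<delta>) l"
proof (cases l)
  case (Suc m)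
  show ?thesis
    using abs_mult_le[OF phi_bounds(4) future_abs_le] by (simp add: Suc future_layer_Suc layer_weight_def)
qed (simp add: future_layer_def layer_weight_def)

lemma past_sum: "past k \<omega> = (\<Sum>i\<le>k. past_layer i \<omega>)"
  by (induction k) (simp_all add: past_layer_def past_def occ_0)

lemma future_sum: "future m \<omega> = (\<Sum>l\<le>m. future_layer l \<omega>)"
  by (induction m) (simp_all add: future_layer_def future_def)

section \<open>Reduction of the future to the position at one time\<close>

text \<open>Each induction step moves the earliest discount factor of the future into the test
  variable \<open>W\<close> and then applies the Markov property over one mesh step. Since
  \<open>W\<close> changes in this way, the induction is over all \<open>W\<close>.\<close>

lemma integral_future:
  assumes "l \<le> n" "adapted_ae (\<tau> (n - l)) W" "\<And>\<omega>. \<bar>W \<omega>\<bar> \<le> c"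
  shows "(\<integral>\<omega>. W \<omega> * (future l \<omega> * f (X T \<omega>)) \<partial>M) = (\<integral>\<omega>. W \<omega> * backward_value l (X (\<tau> (n - l)) \<omega>) \<partial>M)"
  using assms
proof (induction l arbitrary: W)
  case 0
  then show ?case by (simp add: future_def mesh)
next
  case (Suc l)
  define s where "s = \<tau> (n - Suc l)"
  have t: "\<tau> (n - l) = s + \<delta>"
    using Suc.prems(1) by (simp add: s_def of_nat_diff algebra_simps)
  then have st: "s \<le> \<tau> (n - l)" using delta by simp
  have s0: "0 \<le> s" unfolding s_def by (rule tau_nonneg)
  have W': "adapted_ae s (\<lambda>\<omega>. W \<omega> * \<phi> (X s \<omega>))"
    using Suc.prems(2) s0 by (intro adapted_ae_mult adapted_ae_X phi_measurable) (auto simp: s_def)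
  have b: "\<bar>W \<omega> * \<phi> (X s \<omega>)\<bar> \<le> c * 1" for \<omega>
    by (intro abs_mult_le Suc.prems phi_bounds)
  have "(\<integral>\<omega>. W \<omega> * (future (Suc l) \<omega> * f (X T \<omega>)) \<partial>M)
      = (\<integral>\<omega>. W \<omega> * \<phi> (X s \<omega>) * (future l \<omega> * f (X T \<omega>)) \<partial>M)"
    by (simp add: future_Suc s_def mult.assoc)
  also have "\<dots> = (\<integral>\<omega>. W \<omega> * \<phi> (X s \<omega>) * backward_value l (X (\<tau> (n - l)) \<omega>) \<partial>M)"
    using Suc.prems(1) by (intro Suc.IH[OF _ adapted_ae_mono[OF W' st] b[simplified]]) simp
  also have "\<dots> = (\<integral>\<omega>. W \<omega> * \<phi> (X s \<omega>) * transition p (s + \<delta> - s) (backward_value l) (X s \<omega>) \<partial>M)"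
    unfolding t using delta s0
    by (intro markov_bounded[OF _ _ W' b backward_value_measurable backward_value_bound]) auto
  also have "\<dots> = (\<integral>\<omega>. W \<omega> * backward_value (Suc l) (X (\<tau> (n - Suc l)) \<omega>) \<partial>M)"
    by (simp add: s_def mult.assoc)
  finally show ?case .
qed

text \<open>As for \<open>future\<close>, except that the factor moved into \<open>W\<close> last is
  \<phi> - 1; the shorter future left over is handled by \<open>integral_future\<close>.\<close>

lemma integral_future_layer:
  assumes l: "l \<le> n" and W: "adapted_ae (\<tau> (n - l)) W" "\<And>\<omega>. \<bar>W \<omega>\<bar> \<le> c"
  shows "(\<integral>\<omega>. W \<omega> * (future_layer l \<omega> * f (X T \<omega>)) \<partial>M) = (\<integral>\<omega>. W \<omega> * layer_value l (X (\<tau> (n - l)) \<omega>) \<partial>M)"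
proof (cases l)
  case 0
  then show ?thesis by (simp add: future_layer_def layer_value_def mesh)
next
  case (Suc m)
  define s where "s = \<tau> (n - Suc m)"
  have t: "\<tau> (n - m) = s + \<delta>"
    using l by (simp add: s_def Suc of_nat_diff algebra_simps)
  then have st: "s \<le> \<tau> (n - m)" using delta by simp
  have s0: "0 \<le> s" unfolding s_def by (rule tau_nonneg)
  have W': "adapted_ae s (\<lambda>\<omega>. W \<omega> * (\<phi> (X s \<omega>) - 1))"
    using W(1) s0 by (intro adapted_ae_mult adapted_ae_X[where g="\<lambda>x. \<phi> x - 1"]) (auto simp: s_def Suc)
  have b: "\<bar>W \<omega> * (\<phi> (X s \<omega>) - 1)\<bar> \<le> c * (\<rho> * \<delta>)" for \<omega>
    by (intro abs_mult_le W phi_bounds)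
  have "(\<integral>\<omega>. W \<omega> * (future_layer l \<omega> * f (X T \<omega>)) \<partial>M)
      = (\<integral>\<omega>. W \<omega> * (\<phi> (X s \<omega>) - 1) * (future m \<omega> * f (X T \<omega>)) \<partial>M)"
    by (simp add: Suc future_layer_Suc s_def mult.assoc)
  also have "\<dots> = (\<integral>\<omega>. W \<omega> * (\<phi> (X s \<omega>) - 1) * backward_value m (X (\<tau> (n - m)) \<omega>) \<partial>M)"
    using l Suc by (intro integral_future[OF _ adapted_ae_mono[OF W' st] b]) simp
  also have "\<dots> = (\<integral>\<omega>. W \<omega> * (\<phi> (X s \<omega>) - 1) * transition p (s + \<delta> - s) (backward_value m) (X s \<omega>) \<partial>M)"
    unfolding t using delta s0
    by (intro markov_bounded[OF _ _ W' b backward_value_measurable backward_value_bound]) auto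
  also have "\<dots> = (\<integral>\<omega>. W \<omega> * layer_value l (X (\<tau> (n - l)) \<omega>) \<partial>M)"
    by (simp add: s_def Suc layer_value_def mult.assoc)
  finally show ?thesis .
qed

section \<open>One pair of layers on one cell\<close>

text \<open>Away from the cell this is \<open>smoothing\<close> with the past layer known at v =
  \<open>\<tau> i\<close> and the future layer collapsed to the position at w =
  \<open>\<tau> (n - l)\<close>; both gaps are whole multiples of \<delta> up to the motion of t
  inside the cell.\<close>

lemma layer_pair_increment:
  assumes k: "k < n" and i: "i \<le> k" and l: "l \<le> n - Suc k" and t: "\<tau> k \<le> t" "t \<le> \<tau> (Suc k)"
  shows "\<bar>(\<integral>\<omega>. past_layer i \<omega> * future_layer l \<omega> * f (X T \<omega>) * h (X t \<omega>) \<partial>M)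
      - (\<integral>\<omega>. past_layer i \<omega> * future_layer l \<omega> * f (X T \<omega>) * h (X (\<tau> k) \<omega>) \<partial>M)\<bar>
    \<le> CT * N * (layer_weight (\<rho> * \<delta>) i * layer_weight (\<rho> * \<delta>) l * (rec_weight (k - i) + rec_weight (n - Suc k - l)))"
    (is "\<bar>?I t - ?I (\<tau> k)\<bar> \<le> _ * _ * (?c * ?d * ?w)")
proof -
  have cd: "0 \<le> ?c" "0 \<le> ?d" using rho delta by (auto intro!: layer_weight_nonneg)
  have t0: "0 \<le> t" using t tau_nonneg[of k] by linarith
  have [measurable]: "X t \<in> borel_measurable M" using t0 by (rule X_measurable)
  show ?thesis
  proof (cases "i = k \<or> l = n - Suc k")
    \<comment> \<open>One layer borders the cell, so only the bound 1 on the increment of h is used.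
      One of the two weights is then \<open>rec_weight 0\<close> = 1, and CT >= 1 brings the bound
      into the common form.\<close>
    case True
    have b: "\<bar>past_layer i \<omega> * future_layer l \<omega> * f (X T \<omega>)\<bar> \<le> ?c * ?d * N" for \<omega>
      by (intro abs_mult_le past_layer_bound future_layer_bound f_bound)
    have "\<bar>?I t - ?I (\<tau> k)\<bar> \<le> ?c * ?d * N * 1"
    proof (rule integral_diff_bound)
      show "integrable M (\<lambda>\<omega>. past_layer i \<omega> * future_layer l \<omega> * f (X T \<omega>) * h (X t \<omega>))"
        by (rule integrable_bounded[OF _ abs_mult_le[OF b h_abs_le]]) measurable
      show "integrable M (\<lambda>\<omega>. past_layer i \<omega> * future_layer l \<omega> * f (X T \<omega>) * h (X (\<tau> k) \<omega>))"
        by (rule integrable_bounded[OF _ abs_mult_le[OF b h_abs_le]]) measurable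
      fix \<omega>
      have "\<bar>h (X t \<omega>) - h (X (\<tau> k) \<omega>)\<bar> \<le> 1"
        using h_nonneg[of "X t \<omega>"] h_le_1[of "X t \<omega>"] h_nonneg[of "X (\<tau> k) \<omega>"] h_le_1[of "X (\<tau> k) \<omega>"]
        by linarith
      from abs_mult_le[OF b this]
      show "\<bar>past_layer i \<omega> * future_layer l \<omega> * f (X T \<omega>) * h (X t \<omega>)
          - past_layer i \<omega> * future_layer l \<omega> * f (X T \<omega>) * h (X (\<tau> k) \<omega>)\<bar> \<le> ?c * ?d * N * 1"
        by (simp add: right_diff_distrib)
    qed
    also have "\<dots> \<le> ?c * ?d * N * (CT * ?w)"
    proof (rule mult_left_mono)
      have "1 \<le> ?w"
        using True rec_weight_nonneg[of "k - i"] rec_weight_nonneg[of "n - Suc k - l"]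
        by (auto simp: rec_weight_def)
      then show "1 \<le> CT * ?w" using CT_ge_1 mult_mono[of 1 CT 1 ?w] by simp
    qed (use cd N_nonneg in simp)
    finally show ?thesis by (simp add: mult_ac)
  next
    case False
    then have ik: "i < k" and lk: "l < n - Suc k" using i l by auto
    \<comment> \<open>Layer l of the future lives from \<open>\<tau> (n - l)\<close> on, and t may
      run up to \<open>\<tau> (Suc k)\<close>. Hence the future gap is measured from the right end
      of the cell and the past gap from the left end.\<close>
    define w where "w = \<tau> (n - l)"
    have wT: "w \<le> T"
      unfolding w_def mesh[symmetric] using delta by (intro mult_right_mono) auto
    have gap_past: "\<tau> k - \<tau> i = real (k - i) * \<delta>"
      using ik by (simp add: of_nat_diff left_diff_distrib)
    have "w - \<tau> (Suc k) = real (n - Suc k - l) * \<delta>"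
      using lk k by (simp add: w_def of_nat_diff algebra_simps)
    then have gap_future: "real (n - Suc k - l) * \<delta> \<le> w - t" using t by simp
    have pos: "0 < real (k - i) * \<delta>" "0 < real (n - Suc k - l) * \<delta>" using ik lk delta by auto
    have order: "\<tau> i < \<tau> k" "t < w" using gap_past gap_future pos by linarith+
    have td: "t - \<tau> k \<le> \<delta>" "0 \<le> t - \<tau> k" using t by (auto simp: algebra_simps)
    have swap: "?I r = (\<integral>\<omega>. past_layer i \<omega> * h (X r \<omega>) * layer_value l (X w \<omega>) \<partial>M)"
      if r: "\<tau> i \<le> r" "r \<le> w" for r
    proof -
      have r0: "0 \<le> r" using r tau_nonneg[of i] by linarith
      have "?I r = (\<integral>\<omega>. past_layer i \<omega> * h (X r \<omega>) * (future_layer l \<omega> * f (X T \<omega>)) \<partial>M)"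
        by (simp add: mult_ac)
      also have "\<dots> = (\<integral>\<omega>. past_layer i \<omega> * h (X r \<omega>) * layer_value l (X (\<tau> (n - l)) \<omega>) \<partial>M)"
      proof (rule integral_future_layer[where c="?c * 1"])
        show "adapted_ae (\<tau> (n - l)) (\<lambda>\<omega>. past_layer i \<omega> * h (X r \<omega>))"
          using r r0 unfolding w_def
          by (intro adapted_ae_mult adapted_ae_mono[OF past_layer_adapted] adapted_ae_X h_measurable) auto
        show "\<bar>past_layer i \<omega> * h (X r \<omega>)\<bar> \<le> ?c * 1" for \<omega>
          by (intro abs_mult_le past_layer_bound h_abs_le)
      qed (use lk in auto)
      finally show ?thesis unfolding w_def .
    qed
    have "\<bar>?I t - ?I (\<tau> k)\<bar> = \<bar>(\<integral>\<omega>. past_layer i \<omega> * h (X t \<omega>) * layer_value l (X w \<omega>) \<partial>M)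
        - (\<integral>\<omega>. past_layer i \<omega> * h (X (\<tau> k) \<omega>) * layer_value l (X w \<omega>) \<partial>M)\<bar>"
      using swap[of t] swap[of "\<tau> k"] order t by simp
    also have "\<dots> \<le> ?c * (?d * N) * (CT * (t - \<tau> k) / (\<tau> k - \<tau> i) + CT * (t - \<tau> k) / (w - t))"
      by (rule smoothing[OF cond tau_nonneg order(1) t(1) order(2) wT past_layer_adapted past_layer_bound
          h_measurable h_abs_le layer_value_measurable layer_value_bound])
    also have "\<dots> \<le> ?c * (?d * N) * (CT * rec_weight (k - i) + CT * rec_weight (n - Suc k - l))"
    proof (intro mult_left_mono add_mono)
      have "CT * (t - \<tau> k) / (\<tau> k - \<tau> i) \<le> CT * \<delta> / (real (k - i) * \<delta>)"
        unfolding gap_past using td CT_ge_1 pos by (intro divide_right_mono mult_left_mono) auto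
      then show "CT * (t - \<tau> k) / (\<tau> k - \<tau> i) \<le> CT * rec_weight (k - i)"
        using ik delta by (simp add: rec_weight_def)
      have "CT * (t - \<tau> k) / (w - t) \<le> CT * \<delta> / (real (n - Suc k - l) * \<delta>)"
      proof (rule frac_le[OF _ _ pos(2) gap_future])
        show "0 \<le> CT * \<delta>" "CT * (t - \<tau> k) \<le> CT * \<delta>"
          using td CT_ge_1 delta by (auto intro!: mult_left_mono)
      qed
      moreover have "rec_weight (n - Suc k - l) = 1 / real (n - Suc k - l)"
        using lk by (auto simp: rec_weight_def)
      ultimately show "CT * (t - \<tau> k) / (w - t) \<le> CT * rec_weight (n - Suc k - l)"
        using delta by (simp del: of_nat_diff)
    qed (use cd N_nonneg in simp)
    finally show ?thesis by (simp add: algebra_simps)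
  qed
qed

definition defect :: "nat \<Rightarrow> 'w \<Rightarrow> real" where
  "defect k \<omega> = occ (\<tau> (Suc k)) \<omega> - occ (\<tau> k) \<omega> - \<delta> * h (X (\<tau> k) \<omega>)"

lemma defect_measurable[measurable]: "defect k \<in> borel_measurable M"
  using occ_measurable[OF tau_nonneg, of "Suc k"] occ_measurable[OF tau_nonneg, of k]
  unfolding defect_def[abs_def] by measurable

lemma defect_abs_le: "\<bar>defect k \<omega>\<bar> \<le> \<delta>"
proof -
  have "0 \<le> \<delta> * h (X (\<tau> k) \<omega>)" "\<delta> * h (X (\<tau> k) \<omega>) \<le> \<delta>"
    using delta h_nonneg h_le_1 by (auto simp: mult_left_le)
  moreover have "\<tau> (Suc k) - \<tau> k = \<delta>" by (simp add: algebra_simps)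
  ultimately show ?thesis
    using occ_increment[of "\<tau> k" "\<tau> (Suc k)" \<omega>] tau_nonneg[of k] delta
    unfolding defect_def by linarith
qed

text \<open>By Fubini the expectation with the defect is the integral over the cell of the
  increments bounded in \<open>layer_pair_increment\<close>; the length of the cell supplies the
  factor \<delta>.\<close>

lemma layer_pair_defect:
  assumes k: "k < n" and i: "i \<le> k" and l: "l \<le> n - Suc k"
  shows "\<bar>\<integral>\<omega>. past_layer i \<omega> * future_layer l \<omega> * f (X T \<omega>) * defect k \<omega> \<partial>M\<bar>
    \<le> \<delta> * (CT * N * (layer_weight (\<rho> * \<delta>) i * layer_weight (\<rho> * \<delta>) l * (rec_weight (k - i) + rec_weight (n - Suc k - l))))"
    (is "_ \<le> \<delta> * ?B")
proof -
  define W where "W \<omega> = past_layer i \<omega> * future_layer l \<omega> * f (X T \<omega>)" for \<omega>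
  have Wb: "\<bar>W \<omega>\<bar> \<le> layer_weight (\<rho> * \<delta>) i * layer_weight (\<rho> * \<delta>) l * N" for \<omega>
    unfolding W_def by (intro abs_mult_le past_layer_bound future_layer_bound f_bound)
  have Wm[measurable]: "W \<in> borel_measurable M" unfolding W_def[abs_def] by measurable
  have Wi: "integrable M W" using Wm Wb by (rule integrable_bounded)
  let ?J = "{\<tau> k..\<tau> (Suc k)}"
  have J: "0 \<le> \<tau> k" "\<tau> k \<le> \<tau> (Suc k)" using delta by (auto simp: algebra_simps)
  have len: "measure lborel ?J = \<delta>" using J by (simp add: algebra_simps)
  note fub = fubini_hX[OF Wi J]
  have bh: "integrable M (\<lambda>\<omega>. W \<omega> * h (X (\<tau> k) \<omega>))"
    by (rule integrable_bounded[OF _ abs_mult_le[OF Wb h_abs_le]]) measurable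
  have bo: "integrable M (\<lambda>\<omega>. W \<omega> * (occ (\<tau> (Suc k)) \<omega> - occ (\<tau> k) \<omega>))"
  proof (rule integrable_bounded[OF _ abs_mult_le[OF Wb]])
    show "(\<lambda>\<omega>. W \<omega> * (occ (\<tau> (Suc k)) \<omega> - occ (\<tau> k) \<omega>)) \<in> borel_measurable M"
      using occ_measurable[OF tau_nonneg, of "Suc k"] occ_measurable[OF tau_nonneg, of k] by measurable
    show "\<bar>occ (\<tau> (Suc k)) \<omega> - occ (\<tau> k) \<omega>\<bar> \<le> \<tau> (Suc k) - \<tau> k" for \<omega>
      using occ_increment[OF J, of \<omega>] by simp
  qed
  have "(\<integral>\<omega>. W \<omega> * defect k \<omega> \<partial>M)
      = (\<integral>\<omega>. W \<omega> * (occ (\<tau> (Suc k)) \<omega> - occ (\<tau> k) \<omega>) \<partial>M) - \<delta> * (\<integral>\<omega>. W \<omega> * h (X (\<tau> k) \<omega>) \<partial>M)"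
  proof -
    have "(\<lambda>\<omega>. W \<omega> * defect k \<omega>)
        = (\<lambda>\<omega>. W \<omega> * (occ (\<tau> (Suc k)) \<omega> - occ (\<tau> k) \<omega>) - \<delta> * (W \<omega> * h (X (\<tau> k) \<omega>)))"
      by (simp add: fun_eq_iff defect_def algebra_simps)
    then show ?thesis using bo bh by simp
  qed
  also have "(\<integral>\<omega>. W \<omega> * (occ (\<tau> (Suc k)) \<omega> - occ (\<tau> k) \<omega>) \<partial>M) = (\<integral>\<omega>. W \<omega> * (LBINT t:?J. h (X t \<omega>)) \<partial>M)"
    using occ_add[OF _ J] by (intro Bochner_Integration.integral_cong) auto
  also have "\<dots> = (LBINT t:?J. (\<integral>\<omega>. W \<omega> * h (X t \<omega>) \<partial>M))"
    by (rule fub(1))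
  also have "\<delta> * (\<integral>\<omega>. W \<omega> * h (X (\<tau> k) \<omega>) \<partial>M) = (LBINT t:?J. (\<integral>\<omega>. W \<omega> * h (X (\<tau> k) \<omega>) \<partial>M))"
    using len J by (simp add: set_lebesgue_integral_def)
  also have "(LBINT t:?J. (\<integral>\<omega>. W \<omega> * h (X t \<omega>) \<partial>M)) - \<dots>
      = (LBINT t:?J. (\<integral>\<omega>. W \<omega> * h (X t \<omega>) \<partial>M) - (\<integral>\<omega>. W \<omega> * h (X (\<tau> k) \<omega>) \<partial>M))"
    using fub(2) integrable_indicator_Icc[of "\<tau> k" "\<tau> (Suc k)"]
    by (intro set_integral_diff(2)[symmetric]) (auto simp: set_integrable_def)
  also have "\<bar>\<dots>\<bar> \<le> (LBINT t:?J. ?B)"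
  proof -
    have si: "set_integrable lborel ?J (\<lambda>t. (\<integral>\<omega>. W \<omega> * h (X t \<omega>) \<partial>M) - (\<integral>\<omega>. W \<omega> * h (X (\<tau> k) \<omega>) \<partial>M))"
      using fub(2) integrable_indicator_Icc[of "\<tau> k" "\<tau> (Suc k)"]
      by (intro set_integral_diff(1)) (auto simp: set_integrable_def)
    have "\<bar>LBINT t:?J. (\<integral>\<omega>. W \<omega> * h (X t \<omega>) \<partial>M) - (\<integral>\<omega>. W \<omega> * h (X (\<tau> k) \<omega>) \<partial>M)\<bar>
        \<le> (LBINT t:?J. \<bar>(\<integral>\<omega>. W \<omega> * h (X t \<omega>) \<partial>M) - (\<integral>\<omega>. W \<omega> * h (X (\<tau> k) \<omega>) \<partial>M)\<bar>)"
      using set_integral_norm_bound[OF si] by simp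
    also have "\<dots> \<le> (LBINT t:?J. ?B)"
    proof (rule set_integral_mono)
      show "set_integrable lborel ?J (\<lambda>t. \<bar>(\<integral>\<omega>. W \<omega> * h (X t \<omega>) \<partial>M) - (\<integral>\<omega>. W \<omega> * h (X (\<tau> k) \<omega>) \<partial>M)\<bar>)"
        using set_integrable_norm[OF si] by simp
      show "set_integrable lborel ?J (\<lambda>t. ?B)"
        using integrable_indicator_Icc[of "\<tau> k" "\<tau> (Suc k)"] by (auto simp: set_integrable_def)
      fix t assume "t \<in> ?J"
      then show "\<bar>(\<integral>\<omega>. W \<omega> * h (X t \<omega>) \<partial>M) - (\<integral>\<omega>. W \<omega> * h (X (\<tau> k) \<omega>) \<partial>M)\<bar> \<le> ?B"
        unfolding W_def using layer_pair_increment[OF k i l, of t] by auto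
    qed
    finally show ?thesis .
  qed
  also have "\<dots> = \<delta> * ?B" using len J by (simp add: set_lebesgue_integral_def)
  finally show ?thesis unfolding W_def .
qed

section \<open>Summation over layers and cells\<close>

lemma cell_bound:
  assumes k: "k < n"
  shows "\<bar>\<integral>\<omega>. past k \<omega> * future (n - Suc k) \<omega> * f (X T \<omega>) * defect k \<omega> \<partial>M\<bar>
    \<le> \<delta> * (CT * N * (\<Sum>i\<le>k. \<Sum>l\<le>n - Suc k. layer_weight (\<rho> * \<delta>) i * layer_weight (\<rho> * \<delta>) l
        * (rec_weight (k - i) + rec_weight (n - Suc k - l))))"
proof -
  let ?b = "\<lambda>i l \<omega>. past_layer i \<omega> * future_layer l \<omega> * f (X T \<omega>) * defect k \<omega>"
  have i: "integrable M (?b i l)" for i l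
    by (rule integrable_bounded[OF _ abs_mult_le[OF abs_mult_le[OF abs_mult_le[OF past_layer_bound
            future_layer_bound] f_bound] defect_abs_le]]) measurable
  have "(\<integral>\<omega>. past k \<omega> * future (n - Suc k) \<omega> * f (X T \<omega>) * defect k \<omega> \<partial>M)
      = (\<integral>\<omega>. (\<Sum>i\<le>k. \<Sum>l\<le>n - Suc k. ?b i l \<omega>) \<partial>M)"
    unfolding past_sum[of k] future_sum[of "n - Suc k"] sum_product unfolding sum_distrib_right ..
  also have "\<dots> = (\<Sum>i\<le>k. \<Sum>l\<le>n - Suc k. (\<integral>\<omega>. ?b i l \<omega> \<partial>M))"
    using i by (simp add: Bochner_Integration.integral_sum Bochner_Integration.integrable_sum)
  finally have eq: "(\<integral>\<omega>. past k \<omega> * future (n - Suc k) \<omega> * f (X T \<omega>) * defect k \<omega> \<partial>M)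
      = (\<Sum>i\<le>k. \<Sum>l\<le>n - Suc k. (\<integral>\<omega>. ?b i l \<omega> \<partial>M))" .
  have inner: "\<bar>\<Sum>l\<le>n - Suc k. (\<integral>\<omega>. ?b i l \<omega> \<partial>M)\<bar> \<le> (\<Sum>l\<le>n - Suc k. \<delta> * (CT * N *
      (layer_weight (\<rho> * \<delta>) i * layer_weight (\<rho> * \<delta>) l * (rec_weight (k - i) + rec_weight (n - Suc k - l)))))"
    if "i \<le> k" for i
    by (rule order.trans[OF sum_abs sum_mono]) (use layer_pair_defect[OF k that] in auto)
  show ?thesis
    unfolding eq sum_distrib_left
    by (rule order.trans[OF sum_abs sum_mono]) (use inner in auto)
qed

text \<open>Both exponents lie in [0, \<rho> \<delta>], and their linear parts differ by exactly
  \<rho> times the defect.\<close>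

lemma cell_remainder:
  "\<bar>exp (- (\<rho> * (occ (\<tau> (Suc k)) \<omega> - occ (\<tau> k) \<omega>))) - \<phi> (X (\<tau> k) \<omega>) + \<rho> * defect k \<omega>\<bar> \<le> (\<rho> * \<delta>)\<^sup>2 / 2"
proof -
  have "0 \<le> occ (\<tau> (Suc k)) \<omega> - occ (\<tau> k) \<omega>" "occ (\<tau> (Suc k)) \<omega> - occ (\<tau> k) \<omega> \<le> \<delta>"
    using occ_increment[of "\<tau> k" "\<tau> (Suc k)" \<omega>] tau_nonneg[of k] delta by (auto simp: algebra_simps)
  then have "\<bar>exp (- (\<rho> * (occ (\<tau> (Suc k)) \<omega> - occ (\<tau> k) \<omega>))) - exp (- (\<rho> * (\<delta> * h (X (\<tau> k) \<omega>))))
      - (\<rho> * (\<delta> * h (X (\<tau> k) \<omega>)) - \<rho> * (occ (\<tau> (Suc k)) \<omega> - occ (\<tau> k) \<omega>))\<bar> \<le> (\<rho> * \<delta>)\<^sup>2 / 2"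
    using rho delta h_nonneg h_le_1 by (intro exp_minus_diff_linear mult_left_mono mult_nonneg_nonneg)
      (auto simp: mult_left_le)
  then show ?thesis by (simp add: \<phi>_def defect_def algebra_simps)
qed

text \<open>The hybrid products \<open>past k\<close> times \<open>future (n - k)\<close> lead from
  \<open>future n\<close> at k = 0 to \<open>past n\<close> at k = n, and neighbouring ones differ
  only in the clock used on cell k.\<close>

lemma telescope:
  "past n \<omega> - future n \<omega> = (\<Sum>k<n. past k \<omega> * future (n - Suc k) \<omega>
     * (exp (- (\<rho> * (occ (\<tau> (Suc k)) \<omega> - occ (\<tau> k) \<omega>))) - \<phi> (X (\<tau> k) \<omega>)))"
proof -
  have "past n \<omega> * future (n - n) \<omega> - past 0 \<omega> * future (n - 0) \<omega>
      = (\<Sum>k<n. past (Suc k) \<omega> * future (n - Suc k) \<omega> - past k \<omega> * future (n - k) \<omega>)"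
    by (rule sum_lessThan_telescope[symmetric])
  also have "\<dots> = (\<Sum>k<n. past k \<omega> * future (n - Suc k) \<omega>
     * (exp (- (\<rho> * (occ (\<tau> (Suc k)) \<omega> - occ (\<tau> k) \<omega>))) - \<phi> (X (\<tau> k) \<omega>)))"
  proof (rule sum.cong)
    fix k assume "k \<in> {..<n}"
    then have k: "n - k = Suc (n - Suc k)" "n - Suc (n - Suc k) = k" by auto
    have "past (Suc k) \<omega> = past k \<omega> * exp (- (\<rho> * (occ (\<tau> (Suc k)) \<omega> - occ (\<tau> k) \<omega>)))"
      unfolding past_def by (subst exp_add[symmetric]) (simp add: algebra_simps)
    moreover have "future (n - k) \<omega> = \<phi> (X (\<tau> k) \<omega>) * future (n - Suc k) \<omega>"
      unfolding k(1) future_Suc k(2) ..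
    ultimately show "past (Suc k) \<omega> * future (n - Suc k) \<omega> - past k \<omega> * future (n - k) \<omega>
        = past k \<omega> * future (n - Suc k) \<omega>
          * (exp (- (\<rho> * (occ (\<tau> (Suc k)) \<omega> - occ (\<tau> k) \<omega>))) - \<phi> (X (\<tau> k) \<omega>))"
      by (simp add: algebra_simps)
  qed simp
  finally show ?thesis by (simp add: future_def past_def occ_0)
qed

text \<open>The n quadratic remainders add up to N (\<rho> T)^2 / (2 n). The linear parts carry
  \<rho> \<delta> = \<rho> T / n, and their weights are summed by \<open>sum_two_sided_le\<close>,
  where \<rho> \<delta> n = \<rho> T.\<close>

lemma discretization_error:
  "\<bar>\<integral>\<omega>. (past n \<omega> - future n \<omega>) * f (X T \<omega>) \<partial>M\<bar>
    \<le> N * (2 * CT * (\<rho> * T) * (1 + \<rho> * T)\<^sup>2 * (\<Sum>m<n. rec_weight m) + (\<rho> * T)\<^sup>2 / 2) / real n"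
proof -
  let ?e = "\<lambda>k \<omega>. exp (- (\<rho> * (occ (\<tau> (Suc k)) \<omega> - occ (\<tau> k) \<omega>))) - \<phi> (X (\<tau> k) \<omega>)"
  let ?g = "\<lambda>k \<omega>. past k \<omega> * future (n - Suc k) \<omega> * f (X T \<omega>)"
  let ?S = "\<lambda>k. \<Sum>i\<le>k. \<Sum>l\<le>n - Suc k. layer_weight (\<rho> * \<delta>) i * layer_weight (\<rho> * \<delta>) l
        * (rec_weight (k - i) + rec_weight (n - Suc k - l))"
  have pb: "\<bar>past k \<omega>\<bar> \<le> 1" for k \<omega> using past_bounds by (simp add: abs_of_nonneg)
  have gb: "\<bar>?g k \<omega>\<bar> \<le> 1 * 1 * N" for k \<omega>
    by (intro abs_mult_le pb future_abs_le f_bound)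
  have [measurable]: "occ (\<tau> k) \<in> borel_measurable M" for k by (rule occ_measurable[OF tau_nonneg])
  have id: "integrable M (\<lambda>\<omega>. ?g k \<omega> * defect k \<omega>)" for k
    by (rule integrable_bounded[OF _ abs_mult_le[OF gb defect_abs_le]]) measurable
  have ir: "integrable M (\<lambda>\<omega>. ?g k \<omega> * (?e k \<omega> + \<rho> * defect k \<omega>))" for k
    by (rule integrable_bounded[OF _ abs_mult_le[OF gb cell_remainder]]) measurable
  have cell: "\<bar>\<integral>\<omega>. ?g k \<omega> * ?e k \<omega> \<partial>M\<bar> \<le> N * ((\<rho> * \<delta>)\<^sup>2 / 2) + \<rho> * (\<delta> * (CT * N * ?S k))"
    and ie: "integrable M (\<lambda>\<omega>. ?g k \<omega> * ?e k \<omega>)" if k: "k < n" for k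
  proof -
    \<comment> \<open>The cell error is split into its quadratic remainder, bounded pointwise, and
      its linear part, which is small only after taking the expectation.\<close>
    have eq: "(\<lambda>\<omega>. ?g k \<omega> * ?e k \<omega>)
        = (\<lambda>\<omega>. ?g k \<omega> * (?e k \<omega> + \<rho> * defect k \<omega>) - \<rho> * (?g k \<omega> * defect k \<omega>))"
      by (simp add: fun_eq_iff algebra_simps)
    show "integrable M (\<lambda>\<omega>. ?g k \<omega> * ?e k \<omega>)"
      unfolding eq using ir id by (intro Bochner_Integration.integrable_diff integrable_mult_right) auto
    have "(\<integral>\<omega>. ?g k \<omega> * ?e k \<omega> \<partial>M) = (\<integral>\<omega>. ?g k \<omega> * (?e k \<omega> + \<rho> * defect k \<omega>) \<partial>M)
        - \<rho> * (\<integral>\<omega>. ?g k \<omega> * defect k \<omega> \<partial>M)"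
      unfolding eq using ir id by (subst Bochner_Integration.integral_diff) auto
    then have "\<bar>\<integral>\<omega>. ?g k \<omega> * ?e k \<omega> \<partial>M\<bar> \<le> \<bar>\<integral>\<omega>. ?g k \<omega> * (?e k \<omega> + \<rho> * defect k \<omega>) \<partial>M\<bar>
        + \<bar>\<rho> * (\<integral>\<omega>. ?g k \<omega> * defect k \<omega> \<partial>M)\<bar>"
      by (simp only: abs_triangle_ineq4)
    also have "\<dots> \<le> N * ((\<rho> * \<delta>)\<^sup>2 / 2) + \<rho> * (\<delta> * (CT * N * ?S k))"
    proof (rule add_mono)
      have "\<bar>(\<integral>\<omega>. ?g k \<omega> * (?e k \<omega> + \<rho> * defect k \<omega>) \<partial>M) - (\<integral>\<omega>. 0 \<partial>M)\<bar> \<le> 1 * 1 * N * ((\<rho> * \<delta>)\<^sup>2 / 2)"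
      proof (rule integral_diff_bound[OF ir])
        show "\<bar>?g k \<omega> * (?e k \<omega> + \<rho> * defect k \<omega>) - 0\<bar> \<le> 1 * 1 * N * ((\<rho> * \<delta>)\<^sup>2 / 2)" for \<omega>
          unfolding diff_zero by (rule abs_mult_le[OF gb cell_remainder])
      qed simp
      then show "\<bar>\<integral>\<omega>. ?g k \<omega> * (?e k \<omega> + \<rho> * defect k \<omega>) \<partial>M\<bar> \<le> N * ((\<rho> * \<delta>)\<^sup>2 / 2)"
        by (simp only: Bochner_Integration.integral_zero diff_zero mult_1)
      show "\<bar>\<rho> * (\<integral>\<omega>. ?g k \<omega> * defect k \<omega> \<partial>M)\<bar> \<le> \<rho> * (\<delta> * (CT * N * ?S k))"
        unfolding abs_mult using mult_left_mono[OF cell_bound[OF k] rho] rho by simp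
    qed
    finally show "\<bar>\<integral>\<omega>. ?g k \<omega> * ?e k \<omega> \<partial>M\<bar> \<le> N * ((\<rho> * \<delta>)\<^sup>2 / 2) + \<rho> * (\<delta> * (CT * N * ?S k))" .
  qed
  have "(\<integral>\<omega>. (past n \<omega> - future n \<omega>) * f (X T \<omega>) \<partial>M) = (\<integral>\<omega>. (\<Sum>k<n. ?g k \<omega> * ?e k \<omega>) \<partial>M)"
    unfolding telescope sum_distrib_right by (simp only: mult_ac)
  also have "\<dots> = (\<Sum>k<n. \<integral>\<omega>. ?g k \<omega> * ?e k \<omega> \<partial>M)"
    using ie by (intro Bochner_Integration.integral_sum) auto
  finally have "\<bar>\<integral>\<omega>. (past n \<omega> - future n \<omega>) * f (X T \<omega>) \<partial>M\<bar> = \<bar>\<Sum>k<n. \<integral>\<omega>. ?g k \<omega> * ?e k \<omega> \<partial>M\<bar>"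
    by (rule arg_cong)
  also have "\<dots> \<le> (\<Sum>k<n. N * ((\<rho> * \<delta>)\<^sup>2 / 2) + \<rho> * (\<delta> * (CT * N * ?S k)))"
    by (rule order.trans[OF sum_abs sum_mono]) (rule cell, simp)
  also have "\<dots> = real n * (N * ((\<rho> * \<delta>)\<^sup>2 / 2)) + \<rho> * (\<delta> * (CT * N * (\<Sum>k<n. ?S k)))"
    by (simp add: sum.distrib sum_distrib_left)
  also have "\<dots> \<le> real n * (N * ((\<rho> * \<delta>)\<^sup>2 / 2))
      + \<rho> * (\<delta> * (CT * N * (2 * (1 + \<rho> * \<delta> * real n)\<^sup>2 * (\<Sum>m<n. rec_weight m))))"
    using rho delta CT_ge_1 N_nonneg by (intro add_left_mono mult_left_mono sum_two_sided_le) auto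
  also have "\<dots> = N * (2 * CT * (\<rho> * T) * (1 + \<rho> * T)\<^sup>2 * (\<Sum>m<n. rec_weight m) + (\<rho> * T)\<^sup>2 / 2) / real n"
  proof -
    have d: "\<delta> = T / real n" using mesh n_pos by (simp add: field_simps)
    show ?thesis using n_pos by (simp add: d field_simps power2_eq_square)
  qed
  finally show ?thesis .
qed

lemma future_n: "future n \<omega> = exp (- \<rho> * \<delta> * (\<Sum>k<n. h (X (\<tau> k) \<omega>)))"
proof -
  have "future n \<omega> = (\<Prod>k<n. \<phi> (X (\<tau> k) \<omega>))"
    unfolding future_def by (rule prod.nat_diff_reindex)
  also have "\<dots> = exp (\<Sum>k<n. - (\<rho> * \<delta> * h (X (\<tau> k) \<omega>)))"
    unfolding \<phi>_def by (rule exp_sum[symmetric]) simp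
  also have "(\<Sum>k<n. - (\<rho> * \<delta> * h (X (\<tau> k) \<omega>))) = - \<rho> * \<delta> * (\<Sum>k<n. h (X (\<tau> k) \<omega>))"
    unfolding sum_distrib_left by (intro sum.cong) simp_all
  finally show ?thesis .
qed

end

section \<open>The option price\<close>

theorem proposition2:
  fixes M :: "'w measure"
    and X :: "real \<Rightarrow> 'w \<Rightarrow> real"
    and p q :: "real \<Rightarrow> real \<Rightarrow> real \<Rightarrow> real"
    and T CT S0 K L \<rho> r u G :: real
    and S :: "real \<Rightarrow> 'w \<Rightarrow> real"
    and n :: nat
  assumes "prob_space M"
    and "T > 0"
    and "markov_process_with_density M X p"
    and "condition_X p q T CT"
    and "S0 > 0" and "S = asset_price S0 X"
    and "K \<ge> 0" and "\<rho> \<ge> 0"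
    and "u > 1"
    and "integrable M (\<lambda>\<omega>. S T \<omega> powr u)"
    and "G = (\<integral>\<omega>. S T \<omega> powr u \<partial>M)"
    and "n \<ge> 2"
  shows "\<bar>option_price_approx M S r \<rho> K L n T - option_price M S r \<rho> K L T\<bar>
           \<le> 3 * max (const_T_rho CT T \<rho>) G * exp (- r * T)
               * (ln (real n) / real n powr (1 - 1 / u))"
proof -
  define h :: "real \<Rightarrow> real" where "h x = indicator {..L} (S0 * exp x)" for x
  \<comment> \<open>With this level N / n and N^(1 - u) are both equal to \<epsilon>, so the
    discretization error and the tail share the factor \<epsilon>.\<close>
  define N where "N = real n powr (1 / u)"
  define f where "f x = min (max (S0 * exp x - K) 0) N" for x
  define \<delta> where "\<delta> = T / real n"
  define V where "V \<omega> = max (S T \<omega> - K) 0" for \<omega>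
  define \<epsilon> where "\<epsilon> = 1 / real n powr (1 - 1 / u)"
  have N0: "0 < N" using assms by (simp add: N_def)
  interpret prob_space M by fact
  interpret markov_density M X p by unfold_locales fact
  have S: "S t \<omega> = S0 * exp (X t \<omega>)" for t \<omega> using assms by (simp add: asset_price_def)
  interpret discretized_occupation M X p h q T CT \<rho> \<delta> N n f
  proof unfold_locales
    show "h \<in> borel_measurable borel" unfolding h_def[abs_def] by measurable
    show "f \<in> borel_measurable borel" unfolding f_def[abs_def] by measurable
    show "\<bar>f x\<bar> \<le> N" for x using N0 by (simp add: f_def)
  qed (use assms in \<open>auto simp: h_def \<delta>_def indicator_def\<close>)
  have hS: "h (X t \<omega>) = indicator {..L} (S t \<omega>)" for t \<omega> by (simp add: h_def S)
  have Spos: "0 < S T \<omega>" for \<omega> unfolding S using assms(5) by simp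
  have Vf: "f (X T \<omega>) = min (V \<omega>) N" for \<omega> by (simp add: f_def V_def S)
  have Vm[measurable]: "V \<in> borel_measurable M" unfolding V_def[abs_def] S by measurable
  have tail0: "0 \<le> V \<omega> - f (X T \<omega>)" for \<omega>
    unfolding Vf V_def by simp
  have Npow: "N powr (1 - u) = \<epsilon>"
  proof -
    have "1 / u * (1 - u) = - (1 - 1 / u)" using assms(9) by (simp add: field_simps)
    then show ?thesis by (simp only: N_def \<epsilon>_def powr_powr powr_minus_divide)
  qed
  have tail: "V \<omega> - f (X T \<omega>) \<le> \<epsilon> * S T \<omega> powr u" for \<omega>
    using call_tail_bound[OF Spos \<open>0 \<le> K\<close> N0 \<open>1 < u\<close>] unfolding Vf V_def Npow by (simp add: mult.commute)
  have fi: "integrable M (\<lambda>\<omega>. f (X T \<omega>))"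
    by (rule integrable_bounded[OF _ f_bound]) measurable
  have Si: "integrable M (\<lambda>\<omega>. \<epsilon> * S T \<omega> powr u)" using assms(10) by simp
  \<comment> \<open>The moment of order u dominates the excess over the truncated payoff; adding the
    bounded part gives integrability of the payoff itself.\<close>
  have Ri: "integrable M (\<lambda>\<omega>. V \<omega> - f (X T \<omega>))"
    by (rule Bochner_Integration.integrable_bound[OF Si]) (use tail0 tail in \<open>auto intro!: order.trans[OF tail] simp: abs_of_nonneg\<close>)
  have Vi: "integrable M V"
    using Bochner_Integration.integrable_add[OF Ri fi] by simp
  have bounded_mult: "integrable M (\<lambda>\<omega>. W \<omega> * Z \<omega>)"
    if "integrable M Z" "W \<in> borel_measurable M" "\<And>\<omega>. \<bar>W \<omega>\<bar> \<le> 1" for W Z :: "'w \<Rightarrow> real"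
  proof (rule Bochner_Integration.integrable_bound[OF that(1)])
    show "(\<lambda>\<omega>. W \<omega> * Z \<omega>) \<in> borel_measurable M" using that by measurable
    show "AE \<omega> in M. norm (W \<omega> * Z \<omega>) \<le> norm (Z \<omega>)"
      using that(3) by (intro AE_I2) (simp add: abs_mult mult_left_le_one_le)
  qed
  have pb: "\<bar>past n \<omega>\<bar> \<le> 1" for \<omega> using past_bounds by (simp add: abs_of_nonneg)
  have future_nonneg: "0 \<le> future n \<omega>" for \<omega> by (simp add: future_n)
  \<comment> \<open>Both discounts lie in [0, 1], so their difference is bounded by 1 and not by 2;
    the tail costs \<epsilon> G without a further factor.\<close>
  have Db: "\<bar>past n \<omega> - future n \<omega>\<bar> \<le> 1" for \<omega>
    using past_bounds[of n \<omega>] future_nonneg[of \<omega>] future_abs_le[of n \<omega>] by linarith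
  \<comment> \<open>The grid ends at \<open>\<tau> n\<close> = T, so \<open>past n\<close> is the
    full discount. The integrands are compared on \<open>space M\<close> only, where
    \<open>occ\<close> is the actual occupation time.\<close>
  have price: "option_price M S r \<rho> K L T = exp (- r * T) * (\<integral>\<omega>. past n \<omega> * V \<omega> \<partial>M)"
  proof -
    have "(\<integral>\<omega>. exp (- \<rho> * (LBINT t:{0..T}. indicator {..L} (S t \<omega>))) * max (S T \<omega> - K) 0 \<partial>M)
        = (\<integral>\<omega>. past n \<omega> * V \<omega> \<partial>M)"
      by (rule Bochner_Integration.integral_cong) (simp_all add: past_def occ_def mesh hS V_def)
    then show ?thesis by (simp add: option_price_def)
  qed
  have approx: "option_price_approx M S r \<rho> K L n T = exp (- r * T) * (\<integral>\<omega>. future n \<omega> * V \<omega> \<partial>M)"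
    unfolding option_price_approx_def future_n V_def hS by (simp add: \<delta>_def)
  have "(\<integral>\<omega>. past n \<omega> * V \<omega> \<partial>M) - (\<integral>\<omega>. future n \<omega> * V \<omega> \<partial>M)
      = (\<integral>\<omega>. (past n \<omega> - future n \<omega>) * f (X T \<omega>) + (past n \<omega> - future n \<omega>) * (V \<omega> - f (X T \<omega>)) \<partial>M)"
    using bounded_mult[OF Vi past_measurable pb] bounded_mult[OF Vi future_measurable future_abs_le]
    by (subst Bochner_Integration.integral_diff[symmetric]) (simp_all add: algebra_simps)
  also have "\<dots> = (\<integral>\<omega>. (past n \<omega> - future n \<omega>) * f (X T \<omega>) \<partial>M)
      + (\<integral>\<omega>. (past n \<omega> - future n \<omega>) * (V \<omega> - f (X T \<omega>)) \<partial>M)"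
    by (intro Bochner_Integration.integral_add bounded_mult fi Ri Db) measurable
  finally have split: "\<bar>(\<integral>\<omega>. past n \<omega> * V \<omega> \<partial>M) - (\<integral>\<omega>. future n \<omega> * V \<omega> \<partial>M)\<bar>
      \<le> \<bar>\<integral>\<omega>. (past n \<omega> - future n \<omega>) * f (X T \<omega>) \<partial>M\<bar>
        + \<bar>\<integral>\<omega>. (past n \<omega> - future n \<omega>) * (V \<omega> - f (X T \<omega>)) \<partial>M\<bar>"
    by (simp only: abs_triangle_ineq)
  have rest: "\<bar>\<integral>\<omega>. (past n \<omega> - future n \<omega>) * (V \<omega> - f (X T \<omega>)) \<partial>M\<bar> \<le> \<epsilon> * G"
  proof -
    have "\<bar>\<integral>\<omega>. (past n \<omega> - future n \<omega>) * (V \<omega> - f (X T \<omega>)) \<partial>M\<bar>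
        \<le> (\<integral>\<omega>. \<bar>(past n \<omega> - future n \<omega>) * (V \<omega> - f (X T \<omega>))\<bar> \<partial>M)"
      by (rule integral_abs_bound)
    also have "\<dots> \<le> (\<integral>\<omega>. \<epsilon> * S T \<omega> powr u \<partial>M)"
    proof (rule integral_mono[OF _ Si])
      show "integrable M (\<lambda>\<omega>. \<bar>(past n \<omega> - future n \<omega>) * (V \<omega> - f (X T \<omega>))\<bar>)"
        by (intro Bochner_Integration.integrable_abs bounded_mult Ri Db) measurable
      fix \<omega>
      have "\<bar>V \<omega> - f (X T \<omega>)\<bar> \<le> \<epsilon> * S T \<omega> powr u" using tail0[of \<omega>] tail[of \<omega>] by simp
      from abs_mult_le[OF Db this]
      show "\<bar>(past n \<omega> - future n \<omega>) * (V \<omega> - f (X T \<omega>))\<bar> \<le> \<epsilon> * S T \<omega> powr u" by simp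
    qed
    finally show ?thesis using assms(11) by simp
  qed
  have main: "\<bar>\<integral>\<omega>. (past n \<omega> - future n \<omega>) * f (X T \<omega>) \<partial>M\<bar> \<le> \<epsilon> * (const_T_rho CT T \<rho> * ln (real n))"
  proof -
    have "\<bar>\<integral>\<omega>. (past n \<omega> - future n \<omega>) * f (X T \<omega>) \<partial>M\<bar>
        \<le> N * (2 * CT * (\<rho> * T) * (1 + \<rho> * T)\<^sup>2 * (\<Sum>m<n. rec_weight m) + (\<rho> * T)\<^sup>2 / 2) / real n"
      by (rule discretization_error)
    also have "\<dots> = N / real n * (2 * CT * (\<rho> * T) * (1 + \<rho> * T)\<^sup>2 * (\<Sum>m<n. rec_weight m) + (\<rho> * T)\<^sup>2 / 2)"
      by simp
    also have "\<dots> \<le> N / real n * (6 * CT * (\<rho> * T) * (1 + \<rho> * T) * exp (\<rho> * T) * ln (real n))"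
      using N0 CT_ge_1 assms by (intro mult_left_mono discretization_constant) auto
    also have "N / real n = \<epsilon>"
    proof -
      have "N * real n powr (1 - 1 / u) = real n powr 1"
        unfolding N_def by (subst powr_add[symmetric]) simp
      then show ?thesis using assms by (simp add: \<epsilon>_def field_simps)
    qed
    finally show ?thesis by (simp add: const_T_rho_def mult_ac)
  qed
  define B where "B = max (const_T_rho CT T \<rho>) G"
  \<comment> \<open>This is the origin of the factor 3: since 1 <= 2 ln n, the term G without a
    logarithm is at most 2 B ln n, which is added to the B ln n of the discretization error.\<close>
  have ln_n: "2 / 3 \<le> ln (real n)"
    using ln2_ge_two_thirds assms by (intro order.trans[OF ln2_ge_two_thirds]) simp
  have G0: "0 \<le> G" unfolding assms(11) by (rule Bochner_Integration.integral_nonneg) simp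
  have B: "const_T_rho CT T \<rho> \<le> B" "G \<le> B" "0 \<le> B" using G0 by (auto simp: B_def)
  have "const_T_rho CT T \<rho> * ln (real n) + G \<le> B * ln (real n) + B * 1"
    using B ln_n by (intro add_mono mult_right_mono) auto
  also have "\<dots> \<le> B * ln (real n) + B * (2 * ln (real n))"
    using B ln_n by (intro add_left_mono mult_left_mono) auto
  finally have "\<epsilon> * (const_T_rho CT T \<rho> * ln (real n) + G) \<le> \<epsilon> * (3 * B * ln (real n))"
    by (intro mult_left_mono) (auto simp: \<epsilon>_def)
  then have "\<bar>(\<integral>\<omega>. past n \<omega> * V \<omega> \<partial>M) - (\<integral>\<omega>. future n \<omega> * V \<omega> \<partial>M)\<bar> \<le> \<epsilon> * (3 * B * ln (real n))"
    using split main rest unfolding distrib_left by linarith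
  then have "exp (- r * T) * \<bar>(\<integral>\<omega>. past n \<omega> * V \<omega> \<partial>M) - (\<integral>\<omega>. future n \<omega> * V \<omega> \<partial>M)\<bar>
      \<le> exp (- r * T) * (\<epsilon> * (3 * B * ln (real n)))"
    by (rule mult_left_mono) simp
  moreover have "\<bar>option_price_approx M S r \<rho> K L n T - option_price M S r \<rho> K L T\<bar>
      = exp (- r * T) * \<bar>(\<integral>\<omega>. past n \<omega> * V \<omega> \<partial>M) - (\<integral>\<omega>. future n \<omega> * V \<omega> \<partial>M)\<bar>"
    unfolding price approx right_diff_distrib[symmetric] abs_mult by (simp add: abs_minus_commute)
  ultimately show ?thesis
    by (simp add: B_def \<epsilon>_def mult_ac)
qed

end
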